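(* Let $\mathcal{G}(u)=0$ for $u\in X_s$. The following holds: 1. If, for any $u\in X_s$, $\ker(\mathcal{J}(u))$ has finite dimension $r\le N$ and $\ker(\mathcal{J}(u))\subset V_N$, then, for any $a\in\mathbb{R}^N$, $\widehat{J}(a)$ has a kernel of dimension $r$, and the discretisations of the continuous Casimirs are discrete Casimirs; that is, if $\mathcal{F}:X_s\to\mathbb{R}$ is a Casimir of $\mathcal{J}$ and $F(a):=\mathcal{F}\big(\sum_{i=1}^N a_iv_i\big)$, then $\{F,L\}_N=0$ for all $L\in C^1(\mathbb{R}^N)$. 2. If, for any $u\in X_s$, $\ker(\mathcal{J}(u))$ is orthogonal to $V_N$ in $X_s$, then the restriction of any Casimir of $\mathcal{J}$ to $V_N$ is a constant function.
   Context: Hilbert scale: $X_0$ is a separable real Hilbert space with scalar product $\langle\cdot,\cdot\rangle_0$ and Hilbert basis $\{\psi_k\}_{k\in\mathbb{Z}}$; $\{\theta_k\}_{k\in\mathbb{Z}}$ is a positive sequence with $\theta_k\to\infty$ as $|k|\to\infty$; for $r\in\mathbb{Z}$, $X_r$ is the Hilbert space with norm $\|u\|_r^2=\sum_k|\langle u,\psi_k\rangle_0|^2\theta_k^{2r}$ (a completion when $r<0$). The scalar product extends to a duality pairing $X_r\times X_{-r}\to\mathbb{R}$, still denoted $\langle\cdot,\cdot\rangle_0$. Let $s,d\in\mathbb{N}\setminus\{0\}$ with $2s\ge d$, so that $X_s$ is dense in $X_{-s+d}$. For a $C^1$ functional $\mathcal{F}:X_s\to\mathbb{R}$, $\delta\mathcal{F}(u)$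 is defined by $\langle\delta\mathcal{F}(u),\xi\rangle_0=\mathsf{d}\mathcal{F}(u)\xi$ for all $\xi\in X_s$. For each $u\in X_s$, $\mathcal{J}(u):X_{-s+d}\to X_{-s}$ is linear and skew-adjoint with respect to $\langle\cdot,\cdot\rangle_0$, and is a Poisson operator: $\{\mathcal{F},\mathcal{L}\}(u)=\langle\mathcal{J}(u)\delta\mathcal{F}(u),\delta\mathcal{L}(u)\rangle_0$ is skew-symmetric and satisfies the Leibniz rule and the Jacobi identity. The continuous problem (with vanishing dissipation operator $\mathcal{G}$) is $\partial_t u=\mathcal{J}(u)\delta\mathcal{H}(u)$. $\ker(\mathcal{J}(u))$ is the kernel of $\mathcal{J}(u)$; orthogonality to $V_N$ is with respect to the inner product of $X_s$. A Casimir of $\mathcal{J}$ is a functional $\mathcal{F}:X_s\to\mathbb{R}$ such that $\{\mathcal{F},\mathcal{C}\}(u)=0$ for all $u\in X_s$ and all functionals $\mathcal{C}:X_s\to\mathbb{R}$ (so $\delta\mathcal{F}(u)\in\ker\mathcal{J}(u)$). Discretisation: $V_N\subset X_s$ is a finite-dimensional subspace with basis $v_1,\dots,v_N$. For $a\in\mathbb{R}^N$ and $u_N=\sum_i a_iv_i$: $M_{i,j}=\langle v_j,v_i\rangle_0$, $J(a)_{i,j}=\langle\mathcal{J}(u_N)v_j,v_i\rangle_0$, $\widehat{J}(a)=M^{-1}J(a)M^{-1}$, and $\{F,L\}_N(a)=\widehat{J}(a)\nabla F(a)\cdot\nabla L(a)$ for $F,L\in C^1(\mathbb{R}^N)$,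 with $\cdot$ the Euclidean product. A discrete Casimir is a function $F$ with $\{F,L\}_N=0$ for all $L$.
   Formalization: Part 1: the kernel of Ĵ(a) has dimension at least r, equal iff each w in V_N with J(u_N)w orthogonal to V_N lies in ker J(u_N). Part 2: orthogonality is in ⟨·,·⟩_0, or in X_s if V_N is also invariant under ψ_k ↦ θ_k^{2s}ψ_k. As worded both parts are false. *)

theory Defs
  imports "HOL-Analysis.Analysis" "HOL-Library.Function_Algebras"
begin

text \<open>
  The Hilbert scale. \<open>X\<^sub>0\<close> is the whole Hilbert space \<open>'h\<close>, with \<open>\<langle>u, w\<rangle>\<^sub>0 = u \<bullet> w\<close>. For negative
  indices \<open>X\<^sub>r\<close> is a completion, whose elements are formal series \<open>\<Sum>\<^sub>k c\<^sub>k \<psi>\<^sub>k\<close>; we use its standard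
  model, the weighted space of coefficient sequences \<open>c :: int \<Rightarrow> real\<close>. An element \<open>u\<close> of \<open>'h\<close>
  is identified with its coefficient sequence \<open>coef \<psi> u\<close>.

  Coefficient sequences form a real vector space pointwise, so that \<open>span\<close>, \<open>independent\<close> etc.
  apply to them.
\<close>

instantiation "fun" :: (type, real_vector) real_vector
begin

definition scaleR_fun :: "real \<Rightarrow> ('a \<Rightarrow> 'b) \<Rightarrow> 'a \<Rightarrow> 'b" where
  "scaleR_fun a f = (\<lambda>x. a *\<^sub>R f x)"

instance
  by standard (auto simp: scaleR_fun_def fun_eq_iff plus_fun_def algebra_simps)

end

definition hilbert_basis :: "(int \<Rightarrow> 'h::{real_inner,complete_space}) \<Rightarrow> bool" where
  "hilbert_basis \<psi> \<longleftrightarrow>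
     (\<forall>j k. \<psi> j \<bullet> \<psi> k = (if j = k then 1 else 0)) \<and> closure (span (range \<psi>)) = UNIV"

text \<open>On \<open>int\<close>, the filter \<open>cofinite\<close> expresses \<open>\<bar>k\<bar> \<rightarrow> \<infinity>\<close>.\<close>

definition hilbert_scale ::
    "(int \<Rightarrow> 'h::{real_inner,complete_space}) \<Rightarrow> (int \<Rightarrow> real) \<Rightarrow> bool" where
  "hilbert_scale \<psi> \<theta> \<longleftrightarrow>
     hilbert_basis \<psi> \<and> (\<forall>k. 0 < \<theta> k) \<and> filterlim \<theta> at_top cofinite"

definition coef :: "(int \<Rightarrow> 'h::real_inner) \<Rightarrow> 'h \<Rightarrow> int \<Rightarrow> real" where
  "coef \<psi> u = (\<lambda>k. u \<bullet> \<psi> k)"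

definition X :: "(int \<Rightarrow> real) \<Rightarrow> int \<Rightarrow> (int \<Rightarrow> real) set" where
  "X \<theta> r = {c. (\<lambda>k. (c k)\<^sup>2 * \<theta> k powi (2 * r)) summable_on UNIV}"

definition X_inner :: "(int \<Rightarrow> real) \<Rightarrow> int \<Rightarrow> (int \<Rightarrow> real) \<Rightarrow> (int \<Rightarrow> real) \<Rightarrow> real" where
  "X_inner \<theta> r b c = (\<Sum>\<^sub>\<infinity>k. b k * c k * \<theta> k powi (2 * r))"

definition X_norm :: "(int \<Rightarrow> real) \<Rightarrow> int \<Rightarrow> (int \<Rightarrow> real) \<Rightarrow> real" where
  "X_norm \<theta> r c = sqrt (\<Sum>\<^sub>\<infinity>k. (c k)\<^sup>2 * \<theta> k powi (2 * r))"

text \<open>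
  The extension of \<open>\<langle>\<cdot>,\<cdot>\<rangle>\<^sub>0\<close> to \<open>X\<^sub>r \<times> X\<^sub>-\<^sub>r\<close>; the formula does not depend on \<open>r\<close>.
\<close>

definition pairing :: "(int \<Rightarrow> real) \<Rightarrow> (int \<Rightarrow> real) \<Rightarrow> real" where
  "pairing b c = (\<Sum>\<^sub>\<infinity>k. b k * c k)"

text \<open>For \<open>s \<ge> 0\<close>, \<open>X\<^sub>s\<close> as a subset of \<open>X\<^sub>0\<close>; functionals and \<open>V\<^sub>N\<close> live here.\<close>

definition Xs :: "(int \<Rightarrow> 'h::real_inner) \<Rightarrow> (int \<Rightarrow> real) \<Rightarrow> nat \<Rightarrow> 'h set" where
  "Xs \<psi> \<theta> s = {u. coef \<psi> u \<in> X \<theta> (int s)}"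

definition Xs_norm :: "(int \<Rightarrow> 'h::real_inner) \<Rightarrow> (int \<Rightarrow> real) \<Rightarrow> nat \<Rightarrow> 'h \<Rightarrow> real" where
  "Xs_norm \<psi> \<theta> s u = X_norm \<theta> (int s) (coef \<psi> u)"

text \<open>
  Frechet derivatives of functionals on \<open>X\<^sub>s\<close>. They are taken in the norm of \<open>X\<^sub>s\<close>, not in the norm
  of \<open>'h\<close>, so the library's \<open>has_derivative\<close> does not apply. A functional is a
  function on \<open>'h\<close> of which only the values on \<open>X\<^sub>s\<close> matter.
\<close>

definition has_frechet ::
    "(int \<Rightarrow> 'h::real_inner) \<Rightarrow> (int \<Rightarrow> real) \<Rightarrow> nat \<Rightarrow> ('h \<Rightarrow> real) \<Rightarrow> ('h \<Rightarrow> real) \<Rightarrow> 'h \<Rightarrow> bool" where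
  "has_frechet \<psi> \<theta> s F D u \<longleftrightarrow>
     (\<forall>x\<in>Xs \<psi> \<theta> s. \<forall>y\<in>Xs \<psi> \<theta> s. D (x + y) = D x + D y) \<and>
     (\<forall>c. \<forall>x\<in>Xs \<psi> \<theta> s. D (c *\<^sub>R x) = c * D x) \<and>
     (\<exists>C. \<forall>x\<in>Xs \<psi> \<theta> s. \<bar>D x\<bar> \<le> C * Xs_norm \<psi> \<theta> s x) \<and>
     (\<forall>\<epsilon>>0. \<exists>\<delta>>0. \<forall>h\<in>Xs \<psi> \<theta> s. Xs_norm \<psi> \<theta> s h < \<delta> \<longrightarrow>
        \<bar>F (u + h) - F u - D h\<bar> \<le> \<epsilon> * Xs_norm \<psi> \<theta> s h)"

definition C1_functional ::
    "(int \<Rightarrow> 'h::real_inner) \<Rightarrow> (int \<Rightarrow> real) \<Rightarrow> nat \<Rightarrow> ('h \<Rightarrow> real) \<Rightarrow> bool" where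
  "C1_functional \<psi> \<theta> s F \<longleftrightarrow>
     (\<exists>D. (\<forall>u\<in>Xs \<psi> \<theta> s. has_frechet \<psi> \<theta> s F (D u) u) \<and>
          (\<forall>u\<in>Xs \<psi> \<theta> s. \<forall>\<epsilon>>0. \<exists>\<delta>>0. \<forall>w\<in>Xs \<psi> \<theta> s. Xs_norm \<psi> \<theta> s (w - u) < \<delta> \<longrightarrow>
             (\<forall>\<xi>\<in>Xs \<psi> \<theta> s. \<bar>D w \<xi> - D u \<xi>\<bar> \<le> \<epsilon> * Xs_norm \<psi> \<theta> s \<xi>)))"

text \<open>\<open>\<delta>F(u)\<close>, the element of \<open>X\<^sub>-\<^sub>s\<close> that represents the derivative of \<open>F\<close> at \<open>u\<close>.\<close>

definition variation ::
    "(int \<Rightarrow> 'h::real_inner) \<Rightarrow> (int \<Rightarrow> real) \<Rightarrow> nat \<Rightarrow> ('h \<Rightarrow> real) \<Rightarrow> 'h \<Rightarrow> int \<Rightarrow> real" where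
  "variation \<psi> \<theta> s F u =
     (THE g. g \<in> X \<theta> (- int s) \<and>
        (\<exists>D. has_frechet \<psi> \<theta> s F D u \<and> (\<forall>\<xi>\<in>Xs \<psi> \<theta> s. pairing g (coef \<psi> \<xi>) = D \<xi>)))"

text \<open>
  A \<open>C\<^sup>1\<close> functional has \<open>\<delta>F(u)\<close> in \<open>X\<^sub>-\<^sub>s\<close> only, whereas \<open>J(u)\<close> is defined on \<open>X\<^bsub>-s+d\<^esub>\<close> with values
  in \<open>X\<^sub>-\<^sub>s\<close>. Hence \<open>{F, L}(u) = \<langle>J(u) \<delta>F(u), \<delta>L(u)\<rangle>\<^sub>0\<close> is meaningful when \<open>\<delta>F(u)\<close> is in \<open>X\<^bsub>-s+d\<^esub>\<close>
  and \<open>\<delta>L(u)\<close> is in \<open>X\<^sub>s\<close>; the predicate below records where the variations lie.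
\<close>

definition functional_in ::
    "(int \<Rightarrow> 'h::real_inner) \<Rightarrow> (int \<Rightarrow> real) \<Rightarrow> nat \<Rightarrow> int \<Rightarrow> ('h \<Rightarrow> real) \<Rightarrow> bool" where
  "functional_in \<psi> \<theta> s r F \<longleftrightarrow>
     C1_functional \<psi> \<theta> s F \<and> (\<forall>u\<in>Xs \<psi> \<theta> s. variation \<psi> \<theta> s F u \<in> X \<theta> r)"

definition bracket ::
    "(int \<Rightarrow> 'h::real_inner) \<Rightarrow> (int \<Rightarrow> real) \<Rightarrow> nat \<Rightarrow> ('h \<Rightarrow> (int \<Rightarrow> real) \<Rightarrow> int \<Rightarrow> real) \<Rightarrow>
     ('h \<Rightarrow> real) \<Rightarrow> ('h \<Rightarrow> real) \<Rightarrow> 'h \<Rightarrow> real" where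
  "bracket \<psi> \<theta> s J F L u = pairing (J u (variation \<psi> \<theta> s F u)) (variation \<psi> \<theta> s L u)"

definition linear_op ::
    "(int \<Rightarrow> real) \<Rightarrow> int \<Rightarrow> int \<Rightarrow> ((int \<Rightarrow> real) \<Rightarrow> int \<Rightarrow> real) \<Rightarrow> bool" where
  "linear_op \<theta> p q T \<longleftrightarrow>
     (\<forall>x\<in>X \<theta> p. T x \<in> X \<theta> q) \<and>
     (\<forall>x\<in>X \<theta> p. \<forall>y\<in>X \<theta> p. T (x + y) = T x + T y) \<and>
     (\<forall>c. \<forall>x\<in>X \<theta> p. T (c *\<^sub>R x) = c *\<^sub>R T x)"

text \<open>
  The adjoint, with respect to \<open>\<langle>\<cdot>,\<cdot>\<rangle>\<^sub>0\<close>, of an operator \<open>T\<close> from \<open>X\<^bsub>-s+d\<^esub>\<close> to \<open>X\<^sub>-\<^sub>s\<close> maps \<open>X\<^sub>s\<close> to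
  \<open>X\<^bsub>s-d\<^esub>\<close>; skew-adjointness says that it is the restriction of \<open>-T\<close> to \<open>X\<^sub>s\<close>, a subspace of
  \<open>X\<^bsub>-s+d\<^esub>\<close> because \<open>2s \<ge> d\<close>.
\<close>

definition skew_adjoint ::
    "(int \<Rightarrow> real) \<Rightarrow> nat \<Rightarrow> nat \<Rightarrow> ((int \<Rightarrow> real) \<Rightarrow> int \<Rightarrow> real) \<Rightarrow> bool" where
  "skew_adjoint \<theta> s d T \<longleftrightarrow>
     (\<forall>y\<in>X \<theta> (int s). T y \<in> X \<theta> (int s - int d)) \<and>
     (\<forall>x\<in>X \<theta> (- int s + int d). \<forall>y\<in>X \<theta> (int s). pairing (T x) y = - pairing x (T y))"

text \<open>
  The Poisson identities are imposed on the functionals with variations in \<open>X\<^sub>s\<close>, for which all the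
  brackets are defined; the Jacobi identity requires the inner brackets to be such functionals too.
\<close>

definition poisson_operator ::
    "(int \<Rightarrow> 'h::real_inner) \<Rightarrow> (int \<Rightarrow> real) \<Rightarrow> nat \<Rightarrow> nat \<Rightarrow>
     ('h \<Rightarrow> (int \<Rightarrow> real) \<Rightarrow> int \<Rightarrow> real) \<Rightarrow> bool" where
  "poisson_operator \<psi> \<theta> s d J \<longleftrightarrow>
     (let adm = functional_in \<psi> \<theta> s (int s); br = bracket \<psi> \<theta> s J in
       (\<forall>u\<in>Xs \<psi> \<theta> s. linear_op \<theta> (- int s + int d) (- int s) (J u) \<and> skew_adjoint \<theta> s d (J u)) \<and>
       (\<forall>F L. adm F \<longrightarrow> adm L \<longrightarrow> (\<forall>u\<in>Xs \<psi> \<theta> s. br F L u = - br L F u)) \<and>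
       (\<forall>F L K. adm F \<longrightarrow> adm L \<longrightarrow> adm K \<longrightarrow>
          (\<forall>u\<in>Xs \<psi> \<theta> s. br (\<lambda>w. F w * L w) K u = F u * br L K u + br F K u * L u)) \<and>
       (\<forall>F L K. adm F \<longrightarrow> adm L \<longrightarrow> adm K \<longrightarrow>
          adm (br F L) \<longrightarrow> adm (br L K) \<longrightarrow> adm (br K F) \<longrightarrow>
          (\<forall>u\<in>Xs \<psi> \<theta> s. br (br F L) K u + br (br L K) F u + br (br K F) L u = 0)))"

definition ker_op :: "(int \<Rightarrow> real) \<Rightarrow> nat \<Rightarrow> nat \<Rightarrow> ((int \<Rightarrow> real) \<Rightarrow> int \<Rightarrow> real) \<Rightarrow> (int \<Rightarrow> real) set" where
  "ker_op \<theta> s d T = {x \<in> X \<theta> (- int s + int d). T x = 0}"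

text \<open>The library's \<open>dim\<close> is 0 on infinite-dimensional spaces, so finiteness is explicit.\<close>

definition has_finite_dim :: "'v::real_vector set \<Rightarrow> nat \<Rightarrow> bool" where
  "has_finite_dim K r \<longleftrightarrow> (\<exists>B. finite B \<and> independent B \<and> span B = K \<and> card B = r)"

definition casimir ::
    "(int \<Rightarrow> 'h::real_inner) \<Rightarrow> (int \<Rightarrow> real) \<Rightarrow> nat \<Rightarrow> nat \<Rightarrow>
     ('h \<Rightarrow> (int \<Rightarrow> real) \<Rightarrow> int \<Rightarrow> real) \<Rightarrow> ('h \<Rightarrow> real) \<Rightarrow> bool" where
  "casimir \<psi> \<theta> s d J F \<longleftrightarrow>
     functional_in \<psi> \<theta> s (- int s + int d) F \<and>
     (\<forall>C. functional_in \<psi> \<theta> s (int s) C \<longrightarrow> (\<forall>u\<in>Xs \<psi> \<theta> s. bracket \<psi> \<theta> s J F C u = 0))"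

text \<open>The discretisation; the dimension \<open>N\<close> is \<open>CARD('n)\<close>.\<close>

definition galerkin_basis ::
    "(int \<Rightarrow> 'h::real_inner) \<Rightarrow> (int \<Rightarrow> real) \<Rightarrow> nat \<Rightarrow> ('n::finite \<Rightarrow> 'h) \<Rightarrow> bool" where
  "galerkin_basis \<psi> \<theta> s v \<longleftrightarrow> inj v \<and> independent (range v) \<and> range v \<subseteq> Xs \<psi> \<theta> s"

definition VN :: "('n::finite \<Rightarrow> 'h::real_vector) \<Rightarrow> 'h set" where
  "VN v = span (range v)"

definition uN :: "('n::finite \<Rightarrow> 'h::real_vector) \<Rightarrow> real ^ 'n \<Rightarrow> 'h" where
  "uN v a = (\<Sum>i\<in>UNIV. (a $ i) *\<^sub>R v i)"

definition mass_matrix :: "('n::finite \<Rightarrow> 'h::real_inner) \<Rightarrow> real ^ 'n ^ 'n" where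
  "mass_matrix v = (\<chi> i j. v j \<bullet> v i)"

definition J_matrix ::
    "(int \<Rightarrow> 'h::real_inner) \<Rightarrow> ('h \<Rightarrow> (int \<Rightarrow> real) \<Rightarrow> int \<Rightarrow> real) \<Rightarrow> ('n::finite \<Rightarrow> 'h) \<Rightarrow>
     real ^ 'n \<Rightarrow> real ^ 'n ^ 'n" where
  "J_matrix \<psi> J v a = (\<chi> i j. pairing (J (uN v a) (coef \<psi> (v j))) (coef \<psi> (v i)))"

definition J_hat ::
    "(int \<Rightarrow> 'h::real_inner) \<Rightarrow> ('h \<Rightarrow> (int \<Rightarrow> real) \<Rightarrow> int \<Rightarrow> real) \<Rightarrow> ('n::finite \<Rightarrow> 'h) \<Rightarrow>
     real ^ 'n \<Rightarrow> real ^ 'n ^ 'n" where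
  "J_hat \<psi> J v a = matrix_inv (mass_matrix v) ** J_matrix \<psi> J v a ** matrix_inv (mass_matrix v)"

definition gradient :: "(real ^ 'n::finite \<Rightarrow> real) \<Rightarrow> real ^ 'n \<Rightarrow> real ^ 'n" where
  "gradient F a = (\<chi> i. frechet_derivative F (at a) (axis i 1))"

definition C1_fun :: "(real ^ 'n::finite \<Rightarrow> real) \<Rightarrow> bool" where
  "C1_fun F \<longleftrightarrow> (\<forall>a. F differentiable (at a)) \<and> continuous_on UNIV (gradient F)"

definition discrete_bracket ::
    "(real ^ 'n \<Rightarrow> real ^ 'n ^ 'n) \<Rightarrow> (real ^ 'n \<Rightarrow> real) \<Rightarrow> (real ^ 'n \<Rightarrow> real) \<Rightarrow>
     real ^ 'n::finite \<Rightarrow> real" where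
  "discrete_bracket Jh F L a = (Jh a *v gradient F a) \<bullet> gradient L a"

definition discrete_casimir ::
    "(real ^ 'n \<Rightarrow> real ^ 'n ^ 'n) \<Rightarrow> (real ^ 'n::finite \<Rightarrow> real) \<Rightarrow> bool" where
  "discrete_casimir Jh F \<longleftrightarrow>
     C1_fun F \<and> (\<forall>L. C1_fun L \<longrightarrow> (\<forall>a. discrete_bracket Jh F L a = 0))"

end

theory Submission
  imports Defs
begin

text \<open>
  Testing a Casimir \<open>F\<close> against the coordinate functionals \<open>w \<mapsto> \<langle>w, \<psi>\<^sub>k\<rangle>\<^sub>0\<close>, whose variation is
  \<open>\<psi>\<^sub>k\<close>, shows that every coefficient of \<open>J(u) \<delta>F(u)\<close> vanishes, so \<open>\<delta>F(u)\<close> is in the kernel of \<open>J(u)\<close>.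
  If that kernel lies in \<open>V\<^sub>N\<close>, then \<open>\<delta>F(u\<^sub>N) = \<Sum>\<^sub>j b\<^sub>j v\<^sub>j\<close> for some \<open>b\<close>, the gradient of the
  restriction is \<open>M b\<close>, and the discrete operator sends it to \<open>M\<^sup>-\<^sup>1 J(a) b = 0\<close>. The kernel of the discrete
  operator is the image under \<open>M\<close> of the kernel of \<open>J(a)\<close>, which consists of the \<open>w \<in> V\<^sub>N\<close> with
  \<open>J(u\<^sub>N) w\<close> orthogonal to \<open>V\<^sub>N\<close> and hence contains the kernel of \<open>J(u\<^sub>N)\<close>.
  If the kernel is orthogonal to \<open>V\<^sub>N\<close> for the pairing, the derivative of the restriction is zero. Orthogonality in
  \<open>X\<^sub>s\<close> reduces to this case when \<open>V\<^sub>N\<close> is invariant under multiplication of the coefficients by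
  \<open>\<theta>\<^sup>2\<^sup>s\<close>, because that map is injective and so maps the finite-dimensional \<open>V\<^sub>N\<close> onto itself.
\<close>

section \<open>Weighted sequence spaces and the duality pairing\<close>

lemma X_scaleR:
  assumes "x \<in> X \<theta> r"
  shows "c *\<^sub>R x \<in> X \<theta> r"
proof -
  have "(\<lambda>k. c\<^sup>2 * ((x k)\<^sup>2 * \<theta> k powi (2 * r))) summable_on UNIV"
    using assms by (intro summable_on_cmult_right) (simp add: X_def)
  then show ?thesis
    by (simp add: X_def scaleR_fun_def power_mult_distrib mult.assoc)
qed

lemma X_add:
  assumes pos: "\<And>k. 0 < \<theta> k" and "x \<in> X \<theta> r" "y \<in> X \<theta> r"
  shows "x + y \<in> X \<theta> r"
proof -
  have "(\<lambda>k. 2 * ((x k)\<^sup>2 * \<theta> k powi (2 * r)) + 2 * ((y k)\<^sup>2 * \<theta> k powi (2 * r))) summable_on UNIV"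
    using assms(2,3) by (intro summable_on_add summable_on_cmult_right) (simp_all add: X_def)
  then have "(\<lambda>k. (x k + y k)\<^sup>2 * \<theta> k powi (2 * r)) summable_on UNIV"
  proof (rule summable_on_comparison_test)
    fix k
    have w: "0 \<le> \<theta> k powi (2 * r)" using pos[of k] by simp
    have "(x k + y k)\<^sup>2 \<le> 2 * (x k)\<^sup>2 + 2 * (y k)\<^sup>2"
      using zero_le_power2[of "x k - y k"] by (simp add: power2_eq_square algebra_simps)
    from mult_right_mono[OF this w]
    show "(x k + y k)\<^sup>2 * \<theta> k powi (2 * r)
        \<le> 2 * ((x k)\<^sup>2 * \<theta> k powi (2 * r)) + 2 * ((y k)\<^sup>2 * \<theta> k powi (2 * r))"
      by (simp add: algebra_simps)
    show "0 \<le> (x k + y k)\<^sup>2 * \<theta> k powi (2 * r)" using w by simp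
  qed
  then show ?thesis by (simp add: X_def plus_fun_def)
qed

lemma X_zero: "0 \<in> X \<theta> r"
  by (simp add: X_def zero_fun_def)

lemma subspace_X:
  assumes "\<And>k. 0 < \<theta> k"
  shows "subspace (X \<theta> r)"
  using assms by (intro subspaceI X_zero X_add X_scaleR)

lemma weight_minus:
  fixes t :: real
  shows "t powi (2 * - m) = 1 / t powi (2 * m)"
  by (simp add: power_int_minus divide_inverse)

text \<open>Young's inequality with weights: splitting the product as \<open>x k / t\<close> times
  \<open>y k * t\<close> with \<open>t = \<theta> k powi r\<close> dominates it by the terms of the
  two convergent series. Thus \<open>pairing\<close> is a genuine sum here and not the default value
  0 of \<open>infsum\<close>.\<close>

lemma pairing_abs_summable:
  assumes pos: "\<And>k. 0 < \<theta> k" and "x \<in> X \<theta> (- r)" "y \<in> X \<theta> r"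
  shows "(\<lambda>k. \<bar>x k * y k\<bar>) summable_on UNIV"
proof -
  have "(\<lambda>k. (x k)\<^sup>2 * \<theta> k powi (2 * - r) + (y k)\<^sup>2 * \<theta> k powi (2 * r)) summable_on UNIV"
    using assms(2,3) by (intro summable_on_add) (simp_all add: X_def)
  then show ?thesis
  proof (rule summable_on_comparison_test)
    fix k
    define t where "t = \<theta> k powi r"
    have t: "0 < t" using pos[of k] by (simp add: t_def)
    have p: "\<theta> k powi (2 * r) = t\<^sup>2"
      using pos[of k] by (simp add: t_def power_int_mult mult.commute flip: power_int_def)
    have m: "\<theta> k powi (2 * - r) = (1 / t)\<^sup>2"
      unfolding weight_minus p by (simp add: power_divide)
    have "0 \<le> (\<bar>x k\<bar> / t - \<bar>y k\<bar> * t)\<^sup>2" by simp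
    also have "\<dots> = (x k)\<^sup>2 * (1/t)\<^sup>2 + (y k)\<^sup>2 * t\<^sup>2 - 2 * (\<bar>x k\<bar> * \<bar>y k\<bar>)"
      using t by (simp add: power2_diff power_divide power_mult_distrib)
    finally have "2 * \<bar>x k * y k\<bar> \<le> (x k)\<^sup>2 * (1/t)\<^sup>2 + (y k)\<^sup>2 * t\<^sup>2"
      by (simp add: abs_mult)
    then show "\<bar>x k * y k\<bar> \<le> (x k)\<^sup>2 * \<theta> k powi (2 * - r) + (y k)\<^sup>2 * \<theta> k powi (2 * r)"
      unfolding p m by linarith
  qed simp
qed

lemma pairing_summable:
  assumes "\<And>k. 0 < \<theta> k" and "x \<in> X \<theta> (- r)" "y \<in> X \<theta> r"
  shows "(\<lambda>k. x k * y k) summable_on UNIV"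
  using pairing_abs_summable[OF assms] by (rule summable_on_iff_abs_summable_on_real[THEN iffD2, simplified])

lemma pairing_add_left:
  assumes "\<And>k. 0 < \<theta> k" and "x \<in> X \<theta> (- r)" "x' \<in> X \<theta> (- r)" "y \<in> X \<theta> r"
  shows "pairing (x + x') y = pairing x y + pairing x' y"
  unfolding pairing_def plus_fun_def distrib_right
  by (intro infsum_add pairing_summable) (use assms in auto)

lemma pairing_add_right:
  assumes "\<And>k. 0 < \<theta> k" and "x \<in> X \<theta> (- r)" "y \<in> X \<theta> r" "y' \<in> X \<theta> r"
  shows "pairing x (y + y') = pairing x y + pairing x y'"
  unfolding pairing_def plus_fun_def distrib_left
  by (intro infsum_add pairing_summable) (use assms in auto)

lemma pairing_scaleR_left: "pairing (c *\<^sub>R x) y = c * pairing x y"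
  by (simp add: pairing_def scaleR_fun_def mult.assoc infsum_cmult_right')

lemma pairing_scaleR_right: "pairing x (c *\<^sub>R y) = c * pairing x y"
  by (simp add: pairing_def scaleR_fun_def mult.left_commute infsum_cmult_right')

lemma pairing_zero_left: "pairing 0 y = 0"
  by (simp add: pairing_def zero_fun_def)

lemma pairing_zero_right: "pairing x 0 = 0"
  by (simp add: pairing_def zero_fun_def)

text \<open>Since \<theta> tends to infinity, only finitely many weights lie below 1. These
  contribute a finite sum, and on the other indices the weight increases with the exponent.\<close>

lemma X_mono:
  assumes "hilbert_scale \<psi> \<theta>" and "p \<le> q"
  shows "X \<theta> q \<subseteq> X \<theta> p"
proof
  fix x assume x: "x \<in> X \<theta> q"
  have pos: "0 < \<theta> k" for k using assms(1) by (simp add: hilbert_scale_def)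
  have "eventually (\<lambda>k. 1 \<le> \<theta> k) cofinite"
    using assms(1) by (simp add: hilbert_scale_def filterlim_at_top)
  then have fin: "finite {k. \<not> 1 \<le> \<theta> k}" by (simp add: eventually_cofinite)
  have "(\<lambda>k. (x k)\<^sup>2 * \<theta> k powi (2 * q)) summable_on {k. 1 \<le> \<theta> k}"
    using x by (auto simp: X_def intro: summable_on_subset_banach)
  then have "(\<lambda>k. (x k)\<^sup>2 * \<theta> k powi (2 * p)) summable_on {k. 1 \<le> \<theta> k}"
    by (rule summable_on_comparison_test)
      (use assms(2) pos in \<open>auto intro!: mult_left_mono power_int_increasing simp: less_imp_le\<close>)
  moreover have "(\<lambda>k. (x k)\<^sup>2 * \<theta> k powi (2 * p)) summable_on {k. \<not> 1 \<le> \<theta> k}"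
    using fin by (rule summable_on_finite)
  ultimately have "(\<lambda>k. (x k)\<^sup>2 * \<theta> k powi (2 * p)) summable_on ({k. 1 \<le> \<theta> k} \<union> {k. \<not> 1 \<le> \<theta> k})"
    by (rule summable_on_union)
  also have "{k. 1 \<le> \<theta> k} \<union> {k. \<not> 1 \<le> \<theta> k} = UNIV" by auto
  finally show "x \<in> X \<theta> p" by (simp add: X_def)
qed

section \<open>Coefficients with respect to the Hilbert basis\<close>

lemma coef_add: "coef \<psi> (x + y) = coef \<psi> x + coef \<psi> y"
  by (simp add: coef_def plus_fun_def inner_add_left)

lemma coef_scaleR: "coef \<psi> (c *\<^sub>R x) = c *\<^sub>R coef \<psi> x"
  by (simp add: coef_def scaleR_fun_def)

lemma linear_coef: "linear (coef \<psi>)"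
  by (intro linearI coef_add coef_scaleR)

text \<open>Parseval's identity. The partial sums \<open>P A\<close> are orthogonal projections of
  \<open>u\<close>, and density of the span of \<psi> forces the residuals \<open>u - P A\<close> to
  0.\<close>

lemma has_sum_coef_products:
  assumes "hilbert_basis \<psi>"
  shows "((\<lambda>k. coef \<psi> u k * coef \<psi> w k) has_sum (u \<bullet> w)) UNIV"
proof -
  have on: "\<psi> j \<bullet> \<psi> k = (if j = k then 1 else 0)" for j k
    using assms by (simp add: hilbert_basis_def)
  define P where "P A = (\<Sum>k\<in>A. (u \<bullet> \<psi> k) *\<^sub>R \<psi> k)" for A
  have "((\<lambda>A. u - P A) \<longlongrightarrow> 0) (finite_subsets_at_top UNIV)"
  proof (rule tendstoI)
    fix e :: real assume "0 < e"
    have "u \<in> closure (span (range \<psi>))" using assms by (simp add: hilbert_basis_def)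
    then obtain y where y: "y \<in> span (range \<psi>)" "dist y u < e"
      using \<open>0 < e\<close> by (auto simp: closure_approachable)
    from y(1) obtain T c where T: "finite T" "T \<subseteq> range \<psi>" "y = (\<Sum>a\<in>T. c a *\<^sub>R a)"
      by (auto simp: span_explicit)
    from T(1,2) obtain A0 where A0: "finite A0" "T = \<psi> ` A0"
      by (meson finite_subset_image)
    \<comment> \<open>Once \<open>A\<close> contains the finitely many indices used by
      \<open>y\<close>, the residual is orthogonal to \<open>P A - y\<close>, so by Pythagoras
      \<open>P A\<close> approximates \<open>u\<close> at least as well as \<open>y\<close>
      does.\<close>
    have "dist (u - P A) 0 < e" if A: "finite A" "A0 \<subseteq> A" for A
    proof -
      have orth: "(u - P A) \<bullet> \<psi> k = 0" if "k \<in> A" for k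
        using that A(1) by (simp add: P_def inner_diff_left inner_sum_left on if_distrib cong: if_cong)
      have 1: "(u - P A) \<bullet> P A = 0"
        by (subst (2) P_def) (simp add: inner_sum_right orth)
      have 2: "(u - P A) \<bullet> y = 0"
        unfolding T(3) inner_sum_right by (rule sum.neutral) (use A0 A(2) orth in auto)
      have "orthogonal (u - P A) (P A - y)"
        using 1 2 by (simp add: orthogonal_def inner_diff_right)
      then have "(norm (u - P A + (P A - y)))\<^sup>2 = (norm (u - P A))\<^sup>2 + (norm (P A - y))\<^sup>2"
        by (rule norm_add_Pythagorean)
      then have "(norm (u - P A))\<^sup>2 \<le> (norm (u - y))\<^sup>2" by simp
      then have "norm (u - P A) \<le> norm (u - y)"
        by (rule power2_le_imp_le) simp
      with y(2) show ?thesis by (simp add: dist_norm norm_minus_commute)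
    qed
    then show "eventually (\<lambda>A. dist (u - P A) 0 < e) (finite_subsets_at_top UNIV)"
      using A0(1) by (auto simp: eventually_finite_subsets_at_top)
  qed
  then have "((\<lambda>A. u \<bullet> w - (u - P A) \<bullet> w) \<longlongrightarrow> u \<bullet> w - 0 \<bullet> w) (finite_subsets_at_top UNIV)"
    by (intro tendsto_intros)
  moreover have "u \<bullet> w - (u - P A) \<bullet> w = (\<Sum>k\<in>A. coef \<psi> u k * coef \<psi> w k)" for A
    by (simp add: P_def inner_diff_left inner_sum_left coef_def inner_commute[of w])
  ultimately show ?thesis by (simp add: has_sum_def)
qed

lemma pairing_coef:
  assumes "hilbert_basis \<psi>"
  shows "pairing (coef \<psi> u) (coef \<psi> w) = u \<bullet> w"
  unfolding pairing_def by (intro infsumI has_sum_coef_products assms)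

text \<open>By Parseval, a vector with zero coefficients has zero norm.\<close>

lemma inj_coef:
  assumes "hilbert_basis \<psi>"
  shows "inj (coef \<psi>)"
  unfolding linear_injective_0[OF linear_coef]
  by (metis assms inner_eq_zero_iff pairing_coef pairing_zero_left)


lemma coef_basis:
  assumes "hilbert_basis \<psi>"
  shows "coef \<psi> (\<psi> j) = (\<lambda>k. if k = j then 1 else 0)"
  using assms by (auto simp: coef_def hilbert_basis_def)

lemma pairing_basis:
  assumes "hilbert_basis \<psi>"
  shows "pairing g (coef \<psi> (\<psi> j)) = g j"
proof -
  have "pairing g (coef \<psi> (\<psi> j)) = infsum (\<lambda>k. g k * (if k = j then 1 else 0)) {j}"
    unfolding pairing_def coef_basis[OF assms] by (rule infsum_cong_neutral) auto
  then show ?thesis by simp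
qed

lemma coef_finite_sum:
  assumes "hilbert_basis \<psi>" and "finite A"
  shows "coef \<psi> (\<Sum>k\<in>A. a k *\<^sub>R \<psi> k) = (\<lambda>k. if k \<in> A then a k else 0)"
proof -
  have on: "\<psi> j \<bullet> \<psi> k = (if j = k then 1 else 0)" for j k
    using assms by (simp add: hilbert_basis_def)
  show ?thesis
    using assms(2) by (simp add: coef_def inner_sum_left on if_distrib cong: if_cong)
qed

section \<open>The space X_s inside the Hilbert space and its norm\<close>

lemma subspace_Xs:
  assumes "\<And>k. 0 < \<theta> k"
  shows "subspace (Xs \<psi> \<theta> s)"
proof -
  have "Xs \<psi> \<theta> s = coef \<psi> -` X \<theta> (int s)" by (auto simp: Xs_def)
  then show ?thesis
    using linear_subspace_vimage[OF linear_coef subspace_X[of \<theta>]] assms by simp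
qed

lemma basis_in_Xs:
  assumes "hilbert_basis \<psi>"
  shows "\<psi> k \<in> Xs \<psi> \<theta> s"
  unfolding Xs_def X_def mem_Collect_eq coef_basis[OF assms]
  by (rule finite_nonzero_values_imp_summable_on) (auto intro: finite_subset[of _ "{k}"])

lemma Xs_norm_square:
  assumes "\<And>k. 0 < \<theta> k"
  shows "(Xs_norm \<psi> \<theta> s u)\<^sup>2 = (\<Sum>\<^sub>\<infinity>k. (coef \<psi> u k)\<^sup>2 * \<theta> k powi (2 * int s))"
  unfolding Xs_norm_def X_norm_def
  by (intro real_sqrt_pow2 infsum_nonneg mult_nonneg_nonneg) (use assms in \<open>auto simp: less_imp_le\<close>)

lemma Xs_norm_nonneg:
  assumes "\<And>k. 0 < \<theta> k"
  shows "0 \<le> Xs_norm \<psi> \<theta> s u"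
  unfolding Xs_norm_def X_norm_def
  by (intro real_sqrt_ge_zero infsum_nonneg mult_nonneg_nonneg) (use assms in \<open>auto simp: less_imp_le\<close>)

lemma Xs_norm_scaleR: "Xs_norm \<psi> \<theta> s (c *\<^sub>R u) = \<bar>c\<bar> * Xs_norm \<psi> \<theta> s u"
  by (simp add: Xs_norm_def X_norm_def coef_def power_mult_distrib mult.assoc infsum_cmult_right'
      real_sqrt_mult)

text \<open>A single term of the series for the squared X_s norm is at most the whole. This is the
  continuity on X_s of the coordinate functionals against which Casimirs are tested.\<close>

lemma basis_coefficient_bound:
  assumes pos: "\<And>k. 0 < \<theta> k" and u: "u \<in> Xs \<psi> \<theta> s"
  shows "\<bar>u \<bullet> \<psi> k\<bar> \<le> \<theta> k powi (- int s) * Xs_norm \<psi> \<theta> s u"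
proof -
  define t where "t = \<theta> k powi int s"
  have t: "0 < t" using pos[of k] by (simp add: t_def)
  have "(\<Sum>\<^sub>\<infinity>j\<in>{k}. (coef \<psi> u j)\<^sup>2 * \<theta> j powi (2 * int s)) \<le> (Xs_norm \<psi> \<theta> s u)\<^sup>2"
    unfolding Xs_norm_square[OF pos]
    by (rule infsum_mono_neutral) (use u pos in \<open>auto simp: Xs_def X_def less_imp_le\<close>)
  then have "(\<bar>u \<bullet> \<psi> k\<bar> * t)\<^sup>2 \<le> (Xs_norm \<psi> \<theta> s u)\<^sup>2"
    by (simp add: coef_def t_def power_mult_distrib power_int_mult mult.commute[of 2])
  then have "\<bar>u \<bullet> \<psi> k\<bar> * t \<le> Xs_norm \<psi> \<theta> s u"
    by (rule power2_le_imp_le) (rule Xs_norm_nonneg[OF pos])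
  then have "\<bar>u \<bullet> \<psi> k\<bar> \<le> inverse t * Xs_norm \<psi> \<theta> s u"
    using t by (simp add: field_simps)
  then show ?thesis by (simp only: power_int_minus t_def)
qed

section \<open>Derivatives on X_s and their representing elements\<close>

text \<open>Along the ray through \<xi> the difference of the two derivatives is linear in
  \<open>t\<close>, while both remainders are of smaller order in \<open>t\<close>.\<close>

lemma has_frechet_unique:
  assumes pos: "\<And>k. 0 < \<theta> k" and D: "has_frechet \<psi> \<theta> s F D u" and D': "has_frechet \<psi> \<theta> s F D' u"
    and \<xi>: "\<xi> \<in> Xs \<psi> \<theta> s"
  shows "D \<xi> = D' \<xi>"
proof (rule ccontr)
  assume "D \<xi> \<noteq> D' \<xi>"
  define a n where "a = \<bar>D \<xi> - D' \<xi>\<bar>" and "n = Xs_norm \<psi> \<theta> s \<xi>"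
  have a: "0 < a" using \<open>D \<xi> \<noteq> D' \<xi>\<close> by (simp add: a_def)
  have n: "0 \<le> n" unfolding n_def by (rule Xs_norm_nonneg[OF pos])
  \<comment> \<open>The two remainders together give at most \<open>2 * e * n\<close>, which is at
    most \<open>a / 2\<close>, contradicting \<open>0 < a\<close>. The summand 1 covers the case
    \<open>n = 0\<close>.\<close>
  define e where "e = a / (4 * (n + 1))"
  have e: "0 < e" using a n by (simp add: e_def)
  obtain \<delta> where \<delta>: "0 < \<delta>" "\<And>h. h \<in> Xs \<psi> \<theta> s \<Longrightarrow> Xs_norm \<psi> \<theta> s h < \<delta> \<Longrightarrow>
      \<bar>F (u + h) - F u - D h\<bar> \<le> e * Xs_norm \<psi> \<theta> s h"
    using D e unfolding has_frechet_def by meson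
  obtain \<delta>' where \<delta>': "0 < \<delta>'" "\<And>h. h \<in> Xs \<psi> \<theta> s \<Longrightarrow> Xs_norm \<psi> \<theta> s h < \<delta>' \<Longrightarrow>
      \<bar>F (u + h) - F u - D' h\<bar> \<le> e * Xs_norm \<psi> \<theta> s h"
    using D' e unfolding has_frechet_def by meson
  define m where "m = min \<delta> \<delta>'"
  \<comment> \<open>This choice puts \<open>t *\<^sub>R \<xi>\<close> strictly inside both
    balls.\<close>
  define t where "t = m / (2 * (n + 1))"
  have m: "0 < m" using \<delta>(1) \<delta>'(1) by (simp add: m_def)
  have t: "0 < t" using m n by (simp add: t_def)
  have "t * n < m"
    using m n by (simp add: t_def divide_less_eq add_nonneg_pos)
  then have tn: "t * n < \<delta>" "t * n < \<delta>'" by (simp_all add: m_def)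
  define h where "h = t *\<^sub>R \<xi>"
  have h: "h \<in> Xs \<psi> \<theta> s" unfolding h_def using subspace_Xs[OF pos] \<xi> by (rule subspace_scale)
  have nh: "Xs_norm \<psi> \<theta> s h = t * n" using t by (simp add: h_def Xs_norm_scaleR n_def)
  have "D h = t * D \<xi>" "D' h = t * D' \<xi>"
    using D D' \<xi> unfolding has_frechet_def h_def by blast+
  then have "t * a = \<bar>D h - D' h\<bar>"
    using t by (simp add: a_def abs_mult flip: right_diff_distrib)
  also have "\<dots> \<le> 2 * (e * (t * n))"
    using \<delta>(2)[OF h] \<delta>'(2)[OF h] tn unfolding nh by linarith
  finally have "a \<le> 2 * (e * n)"
    using t by (simp add: algebra_simps)
  moreover have "e * n \<le> a / 4"
    using a n by (simp add: e_def field_simps)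
  ultimately show False using a by linarith
qed

text \<open>A bounded functional is represented by its values on the basis. Testing it on finite
  combinations bounds the partial sums of the squared norm of index \<open>- s\<close>. The
  representation passes from finite combinations to \<xi> because truncations converge in
  X_s.\<close>

lemma riesz_representation_Xs:
  assumes pos: "\<And>k. 0 < \<theta> k" and basis: "hilbert_basis \<psi>"
    and add: "\<And>x y. x \<in> Xs \<psi> \<theta> s \<Longrightarrow> y \<in> Xs \<psi> \<theta> s \<Longrightarrow> D (x + y) = D x + D y"
    and scale: "\<And>c x. x \<in> Xs \<psi> \<theta> s \<Longrightarrow> D (c *\<^sub>R x) = c * D x"
    and bound: "\<And>x. x \<in> Xs \<psi> \<theta> s \<Longrightarrow> \<bar>D x\<bar> \<le> C * Xs_norm \<psi> \<theta> s x"
  shows "(\<lambda>k. D (\<psi> k)) \<in> X \<theta> (- int s)"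
    and "\<xi> \<in> Xs \<psi> \<theta> s \<Longrightarrow> pairing (\<lambda>k. D (\<psi> k)) (coef \<psi> \<xi>) = D \<xi>"
proof -
  note sub = subspace_Xs[of \<theta> \<psi> s, OF pos]
  define g where "g = (\<lambda>k. D (\<psi> k))"
  define w where "w k = \<theta> k powi (2 * int s)" for k
  have w: "0 < w k" for k using pos[of k] by (simp add: w_def)
  have w': "\<theta> k powi (2 * - int s) = 1 / w k" for k
    unfolding weight_minus w_def ..
  define P where "P a A = (\<Sum>k\<in>A. a k *\<^sub>R \<psi> k)" for a and A :: "int set"
  have P_in: "P a A \<in> Xs \<psi> \<theta> s" for a A
    unfolding P_def by (intro subspace_sum[OF sub] subspace_scale[OF sub] basis_in_Xs basis)
  have D_P: "D (P a A) = (\<Sum>k\<in>A. a k * g k)" if "finite A" for a A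
    using that
  proof (induction A)
    case empty
    show ?case using scale[OF subspace_0[OF sub], of 0] by (simp add: P_def)
  next
    case (insert j A)
    have "P a (insert j A) = a j *\<^sub>R \<psi> j + P a A" using insert by (simp add: P_def)
    then show ?case
      using insert add[OF subspace_scale[OF sub basis_in_Xs[OF basis]] P_in] scale[OF basis_in_Xs[OF basis]]
      by (simp add: g_def)
  qed
  have "sum (\<lambda>k. (g k)\<^sup>2 / w k) A \<le> C\<^sup>2" if A: "finite A" for A
  proof -
    define S where "S = sum (\<lambda>k. (g k)\<^sup>2 / w k) A"
    have S: "0 \<le> S" unfolding S_def by (intro sum_nonneg) (simp add: w less_imp_le)
    \<comment> \<open>the truncated Riesz representative for the inner product of \<open>X\<^sub>s\<close>\<close>
    define x where "x = P (\<lambda>k. g k / w k) A"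
    have Dx: "D x = S" unfolding x_def D_P[OF A] S_def by (simp add: power2_eq_square)
    have "(Xs_norm \<psi> \<theta> s x)\<^sup>2 = infsum (\<lambda>k. (g k / w k)\<^sup>2 * w k) A"
      unfolding Xs_norm_square[OF pos] x_def P_def coef_finite_sum[OF basis A] w_def[symmetric]
      by (rule infsum_cong_neutral) auto
    also have "\<dots> = S"
      unfolding S_def infsum_finite[OF A] using w
      by (intro sum.cong) (auto simp: power2_eq_square field_simps less_imp_neq[OF w, symmetric])
    finally have nx: "(Xs_norm \<psi> \<theta> s x)\<^sup>2 = S" .
    \<comment> \<open>Both \<open>D x\<close> and the squared norm of \<open>x\<close> equal
      \<open>S\<close>, so boundedness becomes \<open>S\<^sup>2 \<le> C\<^sup>2 * S\<close>, and
      \<open>S\<close> is bounded by \<open>C\<^sup>2\<close> uniformly in \<open>A\<close>.\<close>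
    have "\<bar>S\<bar> \<le> C * Xs_norm \<psi> \<theta> s x" using bound[of x] P_in Dx by (simp add: x_def)
    then have "S\<^sup>2 \<le> (C * Xs_norm \<psi> \<theta> s x)\<^sup>2" using S by (intro power_mono) auto
    then have "S * S \<le> C\<^sup>2 * S"
      unfolding power_mult_distrib nx by (simp add: power2_eq_square)
    then show ?thesis using S zero_le_power2[of C] unfolding S_def[symmetric]
      by (cases "S = 0") (auto simp: mult_le_cancel_right)
  qed
  then have "(\<lambda>k. (g k)\<^sup>2 / w k) summable_on UNIV"
    by (intro nonneg_bounded_partial_sums_imp_summable_on[where C = "C\<^sup>2"])
      (auto simp: w less_imp_le intro: eventually_finite_subsets_at_top_weakI)
  then show "(\<lambda>k. D (\<psi> k)) \<in> X \<theta> (- int s)"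
    unfolding X_def mem_Collect_eq w' g_def by simp
  assume \<xi>: "\<xi> \<in> Xs \<psi> \<theta> s"
  define c where "c = coef \<psi> \<xi>"
  define q where "q k = (c k)\<^sup>2 * w k" for k
  have q: "q summable_on UNIV" using \<xi> by (simp add: Xs_def X_def q_def[abs_def] w_def c_def)
  \<comment> \<open>Removing the truncation leaves exactly the coefficients outside
    \<open>A\<close>, so the squared error is the tail of a convergent series.\<close>
  have tail: "(Xs_norm \<psi> \<theta> s (\<xi> - P c A))\<^sup>2 = infsum q UNIV - sum q A" if A: "finite A" for A
  proof -
    have "coef \<psi> (\<xi> - P c A) = (\<lambda>k. if k \<in> A then 0 else c k)"
      using coef_finite_sum[OF basis A, of c] by (auto simp: P_def coef_def fun_eq_iff inner_diff_left c_def)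
    then have "(Xs_norm \<psi> \<theta> s (\<xi> - P c A))\<^sup>2 = infsum q (UNIV - A)"
      unfolding Xs_norm_square[OF pos] w_def[symmetric] q_def
      by (intro infsum_cong_neutral) auto
    also have "\<dots> = infsum q UNIV - sum q A"
      using infsum_Diff[OF q, of A] A by simp
    finally show ?thesis .
  qed
  have "((\<lambda>A. C * sqrt (infsum q UNIV - sum q A)) \<longlongrightarrow> C * sqrt (infsum q UNIV - infsum q UNIV))
      (finite_subsets_at_top UNIV)"
    by (intro tendsto_mult tendsto_real_sqrt tendsto_diff tendsto_const
        has_sum_infsum[OF q, unfolded has_sum_def])
  then have "((\<lambda>A. C * sqrt (infsum q UNIV - sum q A)) \<longlongrightarrow> 0) (finite_subsets_at_top UNIV)"
    by simp
  then have "((\<lambda>A. (\<Sum>k\<in>A. c k * g k) - D \<xi>) \<longlongrightarrow> 0) (finite_subsets_at_top UNIV)"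
  proof (rule Lim_null_comparison[rotated])
    show "\<forall>\<^sub>F A in finite_subsets_at_top UNIV.
        norm ((\<Sum>k\<in>A. c k * g k) - D \<xi>) \<le> C * sqrt (infsum q UNIV - sum q A)"
    proof (rule eventually_finite_subsets_at_top_weakI)
      fix A :: "int set" assume A: "finite A"
      have in_Xs: "\<xi> - P c A \<in> Xs \<psi> \<theta> s" using sub \<xi> P_in by (rule subspace_diff)
      have "D \<xi> = D (\<xi> - P c A) + D (P c A)" using add[OF in_Xs P_in[of c A]] by simp
      then have "norm ((\<Sum>k\<in>A. c k * g k) - D \<xi>) = \<bar>D (\<xi> - P c A)\<bar>" using D_P[OF A, of c] by simp
      also have "\<dots> \<le> C * Xs_norm \<psi> \<theta> s (\<xi> - P c A)" by (rule bound[OF in_Xs])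
      also have "Xs_norm \<psi> \<theta> s (\<xi> - P c A) = sqrt (infsum q UNIV - sum q A)"
        unfolding tail[OF A, symmetric] by (simp add: Xs_norm_nonneg[OF pos])
      finally show "norm ((\<Sum>k\<in>A. c k * g k) - D \<xi>) \<le> C * sqrt (infsum q UNIV - sum q A)" .
    qed
  qed
  then have "((\<lambda>k. g k * c k) has_sum D \<xi>) UNIV"
    by (simp add: has_sum_def LIM_zero_iff mult.commute)
  then show "pairing (\<lambda>k. D (\<psi> k)) (coef \<psi> \<xi>) = D \<xi>"
    unfolding pairing_def g_def c_def by (rule infsumI)
qed

text \<open>The definite description in \<open>variation\<close> is junk unless a representing element exists and is unique.\<close>

lemma variation_eqI:
  assumes "\<And>k. 0 < \<theta> k" and basis: "hilbert_basis \<psi>"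
    and D: "has_frechet \<psi> \<theta> s F D u" and g: "g \<in> X \<theta> (- int s)"
    and rep: "\<And>\<xi>. \<xi> \<in> Xs \<psi> \<theta> s \<Longrightarrow> pairing g (coef \<psi> \<xi>) = D \<xi>"
  shows "variation \<psi> \<theta> s F u = g"
  unfolding variation_def
proof (rule the_equality)
  fix g'
  assume "g' \<in> X \<theta> (- int s) \<and>
    (\<exists>D. has_frechet \<psi> \<theta> s F D u \<and> (\<forall>\<xi>\<in>Xs \<psi> \<theta> s. pairing g' (coef \<psi> \<xi>) = D \<xi>))"
  then obtain D' where D': "has_frechet \<psi> \<theta> s F D' u"
    and rep': "\<And>\<xi>. \<xi> \<in> Xs \<psi> \<theta> s \<Longrightarrow> pairing g' (coef \<psi> \<xi>) = D' \<xi>" by blast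
  show "g' = g"
  proof
    fix k
    show "g' k = g k"
      using rep[OF basis_in_Xs[OF basis]] rep'[OF basis_in_Xs[OF basis]]
        has_frechet_unique[OF assms(1) D D' basis_in_Xs[OF basis]]
      by (simp add: pairing_basis[OF basis])
  qed
qed (use D g rep in blast)

text \<open>The Riesz representative satisfies the description that defines
  \<open>variation\<close>, so the defining identity of the variation becomes available for every
  derivative \<open>D\<close> of \<open>F\<close>.\<close>

lemma pairing_variation:
  assumes pos: "\<And>k. 0 < \<theta> k" and basis: "hilbert_basis \<psi>"
    and D: "has_frechet \<psi> \<theta> s F D u" and \<xi>: "\<xi> \<in> Xs \<psi> \<theta> s"
  shows "pairing (variation \<psi> \<theta> s F u) (coef \<psi> \<xi>) = D \<xi>"
proof -
  obtain C where C: "\<And>x. x \<in> Xs \<psi> \<theta> s \<Longrightarrow> \<bar>D x\<bar> \<le> C * Xs_norm \<psi> \<theta> s x"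
    using D unfolding has_frechet_def by blast
  have add: "\<And>x y. x \<in> Xs \<psi> \<theta> s \<Longrightarrow> y \<in> Xs \<psi> \<theta> s \<Longrightarrow> D (x + y) = D x + D y"
    and scale: "\<And>c x. x \<in> Xs \<psi> \<theta> s \<Longrightarrow> D (c *\<^sub>R x) = c * D x"
    using D unfolding has_frechet_def by blast+
  note riesz = riesz_representation_Xs[OF pos basis add scale C]
  show ?thesis
    using variation_eqI[OF pos basis D] riesz \<xi> by metis
qed

section \<open>Coordinate functionals as test functionals for Casimirs\<close>

text \<open>The coordinate functional is linear and bounded on X_s, hence its own derivative at
  every point, and Parseval identifies the representing element as the coefficient sequence of
  \<open>\<psi> k\<close>.\<close>

lemma
  assumes pos: "\<And>k. 0 < \<theta> k" and basis: "hilbert_basis \<psi>"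
  shows variation_coefficient: "variation \<psi> \<theta> s (\<lambda>w. w \<bullet> \<psi> k) u = coef \<psi> (\<psi> k)"
    and C1_functional_coefficient: "C1_functional \<psi> \<theta> s (\<lambda>w. w \<bullet> \<psi> k)"
proof -
  have D: "has_frechet \<psi> \<theta> s (\<lambda>w. w \<bullet> \<psi> k) (\<lambda>\<xi>. \<xi> \<bullet> \<psi> k) u" for u
    unfolding has_frechet_def
    using basis_coefficient_bound[of \<theta> _ \<psi> s k, OF pos]
    by (auto simp: inner_add_left Xs_norm_nonneg[OF pos] intro: zero_less_one
        intro!: exI[of _ "\<theta> k powi (- int s)"])
  show "variation \<psi> \<theta> s (\<lambda>w. w \<bullet> \<psi> k) u = coef \<psi> (\<psi> k)"
  proof (rule variation_eqI[OF pos basis D])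
    show "coef \<psi> (\<psi> k) \<in> X \<theta> (- int s)"
      unfolding X_def mem_Collect_eq coef_basis[OF basis]
      by (rule finite_nonzero_values_imp_summable_on) (auto intro: finite_subset[of _ "{k}"])
    show "pairing (coef \<psi> (\<psi> k)) (coef \<psi> \<xi>) = \<xi> \<bullet> \<psi> k" for \<xi>
      by (simp add: pairing_coef[OF basis] inner_commute)
  qed
  show "C1_functional \<psi> \<theta> s (\<lambda>w. w \<bullet> \<psi> k)"
    \<comment> \<open>The derivative does not vary with the base point, so the radius 1 serves for
      every \<epsilon>.\<close>
    unfolding C1_functional_def
    by (intro exI[of _ "\<lambda>u \<xi>. \<xi> \<bullet> \<psi> k"])
      (auto simp: D Xs_norm_nonneg[OF pos] intro!: exI[of _ 1])
qed

text \<open>The coordinate functionals have variations in X_s, so the Casimir property applies to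
  them, and pairing with \<open>coef \<psi> (\<psi> k)\<close> reads off the coefficient with index
  \<open>k\<close>.\<close>

lemma casimir_variation_in_kernel:
  assumes pos: "\<And>k. 0 < \<theta> k" and basis: "hilbert_basis \<psi>"
    and F: "casimir \<psi> \<theta> s d J F" and u: "u \<in> Xs \<psi> \<theta> s"
  shows "variation \<psi> \<theta> s F u \<in> ker_op \<theta> s d (J u)"
proof -
  have "J u (variation \<psi> \<theta> s F u) k = 0" for k
  proof -
    have "functional_in \<psi> \<theta> s (int s) (\<lambda>w. w \<bullet> \<psi> k)"
      unfolding functional_in_def
      using C1_functional_coefficient[of \<theta>, OF pos basis] basis_in_Xs[OF basis, of k \<theta> s]
      unfolding variation_coefficient[of \<theta>, OF pos basis] Xs_def by blast
    then have "bracket \<psi> \<theta> s J F (\<lambda>w. w \<bullet> \<psi> k) u = 0"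
      using F u by (simp add: casimir_def)
    then show ?thesis
      by (simp add: bracket_def variation_coefficient[of \<theta>, OF pos basis] pairing_basis[OF basis])
  qed
  then have "J u (variation \<psi> \<theta> s F u) = 0" by (simp add: fun_eq_iff zero_fun_def)
  then show ?thesis
    using F u by (simp add: ker_op_def casimir_def functional_in_def)
qed


section \<open>The Galerkin space and restriction of functionals to it\<close>

lemma linear_uN: "linear (uN v)"
  by (rule linearI) (simp_all add: uN_def scaleR_add_left sum.distrib scaleR_sum_right)

lemma uN_axis: "uN v (axis i 1) = v i"
  by (simp add: uN_def axis_def if_distrib[of "\<lambda>c. c *\<^sub>R _"] cong: if_cong)

lemma range_uN: "range (uN v) = VN v"
proof
  have "uN v a \<in> VN v" for a
    unfolding uN_def VN_def by (rule span_sum) (rule span_scale, rule span_base, rule rangeI)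
  then show "range (uN v) \<subseteq> VN v" by blast
  have "range v \<subseteq> range (uN v)" by (metis image_subsetI rangeI uN_axis)
  then show "VN v \<subseteq> range (uN v)"
    unfolding VN_def by (rule span_minimal) (rule linear_subspace_image[OF linear_uN subspace_UNIV])
qed

lemma inj_uN:
  assumes "galerkin_basis \<psi> \<theta> s v"
  shows "inj (uN v)"
  unfolding linear_injective_0[OF linear_uN]
proof safe
  fix a assume "uN v a = 0"
  have v: "inj v" "independent (range v)" using assms by (auto simp: galerkin_basis_def)
  \<comment> \<open>Independence concerns the set \<open>range v\<close>. As \<open>v\<close> is
    injective, the sum over indices can be rewritten over this set, with \<open>inv v\<close>
    recovering the index of each vector.\<close>
  have sum0: "(\<Sum>x\<in>range v. (a $ inv v x) *\<^sub>R x) = 0"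
    using \<open>uN v a = 0\<close> by (simp add: sum.reindex[OF v(1)] inv_f_f[OF v(1)] uN_def)
  have "a $ inv v (v i) = 0" for i
    by (rule independentD[OF v(2) _ subset_refl sum0]) auto
  then show "a = 0" by (simp add: inv_f_f[OF v(1)] vec_eq_iff)
qed

lemma VN_subset_Xs:
  assumes "\<And>k. 0 < \<theta> k" and "galerkin_basis \<psi> \<theta> s v"
  shows "VN v \<subseteq> Xs \<psi> \<theta> s"
  unfolding VN_def
  by (rule span_minimal[OF _ subspace_Xs]) (use assms in \<open>auto simp: galerkin_basis_def\<close>)

lemma uN_in_Xs:
  assumes "\<And>k. 0 < \<theta> k" and "galerkin_basis \<psi> \<theta> s v"
  shows "uN v a \<in> Xs \<psi> \<theta> s"
  using VN_subset_Xs[OF assms] range_uN[of v] by auto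

lemma has_sum_finite_sum:
  fixes f :: "'i \<Rightarrow> 'a \<Rightarrow> 'b::topological_comm_monoid_add"
  assumes "\<And>i. i \<in> I \<Longrightarrow> (f i has_sum S i) A"
  shows "((\<lambda>k. \<Sum>i\<in>I. f i k) has_sum (\<Sum>i\<in>I. S i)) A"
  using assms by (induction I rule: infinite_finite_induct) (auto intro: has_sum_add)

text \<open>Cauchy-Schwarz over the index \<open>i\<close>, applied to each coefficient
  \<open>k\<close> separately, followed by summation over \<open>k\<close> with the weights. The
  summand 1 in the constant makes it positive, so that it can serve as a divisor.\<close>

lemma Xs_norm_uN_bound:
  assumes pos: "\<And>k. 0 < \<theta> k" and v: "galerkin_basis \<psi> \<theta> s v"
  shows "\<exists>K>0. \<forall>h. Xs_norm \<psi> \<theta> s (uN v h) \<le> K * norm h"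
proof -
  define S where "S = (\<Sum>i\<in>UNIV. (Xs_norm \<psi> \<theta> s (v i))\<^sup>2)"
  have S: "0 \<le> S" by (simp add: S_def sum_nonneg)
  define w where "w k = \<theta> k powi (2 * int s)" for k
  have w: "0 < w k" for k using pos[of k] by (simp add: w_def)
  have "Xs_norm \<psi> \<theta> s (uN v h) \<le> (sqrt S + 1) * norm h" for h
  proof -
    have "((\<lambda>k. (coef \<psi> (v i) k)\<^sup>2 * w k) has_sum (Xs_norm \<psi> \<theta> s (v i))\<^sup>2) UNIV" for i
      unfolding Xs_norm_square[OF pos] w_def
      by (rule has_sum_infsum) (use v in \<open>auto simp: galerkin_basis_def Xs_def X_def\<close>)
    then have "((\<lambda>k. \<Sum>i\<in>UNIV. (coef \<psi> (v i) k)\<^sup>2 * w k) has_sum S) UNIV"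
      unfolding S_def by (intro has_sum_finite_sum)
    from has_sum_cmult_right[OF this, of "(norm h)\<^sup>2"]
    have major: "((\<lambda>k. (norm h)\<^sup>2 * (\<Sum>i\<in>UNIV. (coef \<psi> (v i) k)\<^sup>2 * w k)) has_sum (norm h)\<^sup>2 * S) UNIV" .
    have "((\<lambda>k. (coef \<psi> (uN v h) k)\<^sup>2 * w k) has_sum (Xs_norm \<psi> \<theta> s (uN v h))\<^sup>2) UNIV"
      unfolding Xs_norm_square[OF pos] w_def
      by (rule has_sum_infsum) (use uN_in_Xs[of \<theta>, OF pos v] in \<open>auto simp: Xs_def X_def\<close>)
    then have "(Xs_norm \<psi> \<theta> s (uN v h))\<^sup>2 \<le> (norm h)\<^sup>2 * S"
      using major
    proof (rule has_sum_mono)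
      fix k
      have "(coef \<psi> (uN v h) k)\<^sup>2 = (\<Sum>i\<in>UNIV. h $ i * coef \<psi> (v i) k)\<^sup>2"
        by (simp add: uN_def coef_def inner_sum_left)
      also have "\<dots> \<le> (\<Sum>i\<in>UNIV. (h $ i)\<^sup>2) * (\<Sum>i\<in>UNIV. (coef \<psi> (v i) k)\<^sup>2)"
        by (rule Cauchy_Schwarz_ineq_sum)
      also have "(\<Sum>i\<in>UNIV. (h $ i)\<^sup>2) = (norm h)\<^sup>2"
        by (simp add: power2_norm_eq_inner inner_vec_def) (simp add: power2_eq_square)
      finally show "(coef \<psi> (uN v h) k)\<^sup>2 * w k \<le> (norm h)\<^sup>2 * (\<Sum>i\<in>UNIV. (coef \<psi> (v i) k)\<^sup>2 * w k)"
        using w[of k] by (simp add: mult_right_mono flip: sum_distrib_right mult.assoc)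
    qed
    then have "Xs_norm \<psi> \<theta> s (uN v h) \<le> sqrt ((norm h)\<^sup>2 * S)" by (rule real_le_rsqrt)
    also have "\<dots> \<le> (sqrt S + 1) * norm h" by (simp add: real_sqrt_mult algebra_simps)
    finally show ?thesis .
  qed
  moreover have "0 < sqrt S + 1" using S by (simp add: add_nonneg_pos)
  ultimately show ?thesis by blast
qed

text \<open>The chain rule for the linear map \<open>uN v\<close>. Its bound \<open>K\<close> from
  the Euclidean norm to the X_s norm turns the radius \<delta> into \<open>\<delta> / K\<close> and
  the tolerance \<open>e / K\<close> into \<open>e\<close>.\<close>

lemma has_derivative_restrict:
  assumes pos: "\<And>k. 0 < \<theta> k" and v: "galerkin_basis \<psi> \<theta> s v"
    and D: "has_frechet \<psi> \<theta> s F D (uN v a)"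
  shows "((\<lambda>a. F (uN v a)) has_derivative (\<lambda>h. D (uN v h))) (at a)"
  unfolding has_derivative_at_alt
proof (intro conjI allI impI)
  note in_Xs = uN_in_Xs[of \<theta>, OF pos v]
  have "D (x + y) = D x + D y" if "x \<in> Xs \<psi> \<theta> s" "y \<in> Xs \<psi> \<theta> s" for x y
    using D that unfolding has_frechet_def by blast
  moreover have "D (c *\<^sub>R x) = c * D x" if "x \<in> Xs \<psi> \<theta> s" for c x
    using D that unfolding has_frechet_def by blast
  ultimately have "linear (\<lambda>h. D (uN v h))"
    by (intro linearI) (simp_all add: linear_add[OF linear_uN] linear_scale[OF linear_uN] in_Xs)
  then show "bounded_linear (\<lambda>h. D (uN v h))" by (simp add: linear_conv_bounded_linear)
  fix e :: real assume e: "0 < e"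
  obtain K where K: "0 < K" "\<And>h. Xs_norm \<psi> \<theta> s (uN v h) \<le> K * norm h"
    using Xs_norm_uN_bound[OF pos v] by blast
  have eK: "0 < e / K" using e K(1) by simp
  obtain \<delta> where \<delta>: "0 < \<delta>" "\<And>h. h \<in> Xs \<psi> \<theta> s \<Longrightarrow> Xs_norm \<psi> \<theta> s h < \<delta> \<Longrightarrow>
      \<bar>F (uN v a + h) - F (uN v a) - D h\<bar> \<le> e / K * Xs_norm \<psi> \<theta> s h"
    using D eK unfolding has_frechet_def by meson
  have "norm (F (uN v b) - F (uN v a) - D (uN v (b - a))) \<le> e * norm (b - a)"
    if b: "norm (b - a) < \<delta> / K" for b
  proof -
    have "Xs_norm \<psi> \<theta> s (uN v (b - a)) < \<delta>"
      using K(2)[of "b - a"] b K(1) by (simp add: field_simps)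
    from \<delta>(2)[OF in_Xs this]
    have "norm (F (uN v b) - F (uN v a) - D (uN v (b - a))) \<le> e / K * Xs_norm \<psi> \<theta> s (uN v (b - a))"
      by (simp add: linear_diff[OF linear_uN])
    also have "\<dots> \<le> e / K * (K * norm (b - a))"
      using K e by (intro mult_left_mono) auto
    finally show ?thesis using K(1) by simp
  qed
  then show "\<exists>d>0. \<forall>b. norm (b - a) < d \<longrightarrow>
      norm (F (uN v b) - F (uN v a) - D (uN v (b - a))) \<le> e * norm (b - a)"
    using \<delta>(1) K(1) by (intro exI[of _ "\<delta> / K"]) auto
qed

lemma gradient_restrict:
  assumes pos: "\<And>k. 0 < \<theta> k" and v: "galerkin_basis \<psi> \<theta> s v"
    and D: "has_frechet \<psi> \<theta> s F D (uN v a)"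
  shows "gradient (\<lambda>a. F (uN v a)) a = (\<chi> i. D (v i))"
  unfolding gradient_def frechet_derivative_at[OF has_derivative_restrict[OF assms], symmetric] uN_axis ..

text \<open>The partial derivatives of the restriction are \<open>D (uN v a) (v i)\<close>. They are
  continuous in \<open>a\<close> because \<open>D\<close> is continuous in the dual norm of X_s and
  \<open>uN v\<close> is Lipschitz into X_s.\<close>

lemma C1_fun_restrict:
  assumes pos: "\<And>k. 0 < \<theta> k" and v: "galerkin_basis \<psi> \<theta> s v" and F: "C1_functional \<psi> \<theta> s F"
  shows "C1_fun (\<lambda>a. F (uN v a))"
proof -
  note in_Xs = uN_in_Xs[of \<theta>, OF pos v]
  obtain D where D: "\<And>u. u \<in> Xs \<psi> \<theta> s \<Longrightarrow> has_frechet \<psi> \<theta> s F (D u) u"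
    and cont: "\<And>u \<epsilon>. u \<in> Xs \<psi> \<theta> s \<Longrightarrow> \<epsilon> > 0 \<Longrightarrow>
      \<exists>\<delta>>0. \<forall>w\<in>Xs \<psi> \<theta> s. Xs_norm \<psi> \<theta> s (w - u) < \<delta> \<longrightarrow>
             (\<forall>\<xi>\<in>Xs \<psi> \<theta> s. \<bar>D w \<xi> - D u \<xi>\<bar> \<le> \<epsilon> * Xs_norm \<psi> \<theta> s \<xi>)"
    using F unfolding C1_functional_def by blast
  obtain K where K: "0 < K" "\<And>h. Xs_norm \<psi> \<theta> s (uN v h) \<le> K * norm h"
    using Xs_norm_uN_bound[OF pos v] by blast
  have "continuous_on UNIV (\<lambda>a. D (uN v a) (v i))" for i
    unfolding continuous_on_iff
  proof (intro ballI allI impI)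
    fix a and e :: real assume e: "0 < e"
    define n where "n = Xs_norm \<psi> \<theta> s (v i)"
    have n: "0 \<le> n" unfolding n_def by (rule Xs_norm_nonneg[OF pos])
    \<comment> \<open>Dividing by \<open>n + 1\<close> keeps the final estimate strictly below
      \<open>e\<close>, also when \<open>n = 0\<close>.\<close>
    have "0 < e / (n + 1)" using e n by simp
    from cont[OF in_Xs[of a] this] obtain \<delta> where \<delta>: "0 < \<delta>"
      "\<And>w \<xi>. w \<in> Xs \<psi> \<theta> s \<Longrightarrow> Xs_norm \<psi> \<theta> s (w - uN v a) < \<delta> \<Longrightarrow> \<xi> \<in> Xs \<psi> \<theta> s \<Longrightarrow>
         \<bar>D w \<xi> - D (uN v a) \<xi>\<bar> \<le> e / (n + 1) * Xs_norm \<psi> \<theta> s \<xi>"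
      by blast
    have vi: "v i \<in> Xs \<psi> \<theta> s" using v by (auto simp: galerkin_basis_def)
    have "dist (D (uN v b) (v i)) (D (uN v a) (v i)) < e" if b: "dist b a < \<delta> / K" for b
    proof -
      have "Xs_norm \<psi> \<theta> s (uN v b - uN v a) < \<delta>"
        using K(2)[of "b - a"] b K(1) by (simp add: linear_diff[OF linear_uN] dist_norm field_simps)
      from \<delta>(2)[OF in_Xs this vi]
      have "dist (D (uN v b) (v i)) (D (uN v a) (v i)) \<le> e / (n + 1) * n"
        by (simp add: dist_real_def n_def)
      also have "\<dots> < e" using e n by (simp add: field_simps)
      finally show ?thesis .
    qed
    then show "\<exists>d>0. \<forall>b\<in>UNIV. dist b a < d \<longrightarrow> dist (D (uN v b) (v i)) (D (uN v a) (v i)) < e"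
      using \<delta>(1) K(1) by (intro exI[of _ "\<delta> / K"]) auto
  qed
  then have "continuous_on UNIV (\<lambda>a. \<chi> i. D (uN v a) (v i))"
    by (rule continuous_on_vec_lambda)
  moreover have "gradient (\<lambda>a. F (uN v a)) = (\<lambda>a. \<chi> i. D (uN v a) (v i))"
    using gradient_restrict[OF pos v D[OF in_Xs]] by (simp add: fun_eq_iff)
  moreover have "(\<lambda>a. F (uN v a)) differentiable at a" for a
    using has_derivative_restrict[OF pos v D[OF in_Xs[of a]]] by (auto simp: differentiable_def)
  ultimately show ?thesis by (simp add: C1_fun_def)
qed

section \<open>Mass matrix and discrete Poisson matrix\<close>

lemma mass_matrix_mult: "mass_matrix v *v b = (\<chi> i. uN v b \<bullet> v i)"
  by (simp add: mass_matrix_def matrix_vector_mult_def uN_def inner_sum_left mult.commute)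

text \<open>A null vector \<open>b\<close> makes \<open>uN v b\<close> orthogonal to every
  \<open>v i\<close>, hence to itself, and independence forces \<open>b = 0\<close>.\<close>

lemma invertible_mass_matrix:
  assumes "galerkin_basis \<psi> \<theta> s v"
  shows "invertible (mass_matrix v)"
  unfolding invertible_left_inverse matrix_left_invertible_ker
proof safe
  fix b assume "mass_matrix v *v b = 0"
  then have z: "uN v b \<bullet> v i = 0" for i by (simp add: mass_matrix_mult vec_eq_iff)
  have "uN v b \<bullet> uN v b = 0" by (subst (2) uN_def) (simp add: inner_sum_right z)
  then have "uN v b = 0" by simp
  then show "b = 0" using inj_uN[OF assms] by (simp add: linear_injective_0[OF linear_uN])
qed

lemma mass_matrix_inverse:
  assumes "galerkin_basis \<psi> \<theta> s v"
  shows "matrix_inv (mass_matrix v) *v (mass_matrix v *v b) = b"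
    and "mass_matrix v *v (matrix_inv (mass_matrix v) *v b) = b"
proof -
  have "matrix_inv (mass_matrix v) ** mass_matrix v = mat 1"
    "mass_matrix v ** matrix_inv (mass_matrix v) = mat 1"
    using invertible_mass_matrix[OF assms] unfolding matrix_inv_def invertible_def
    by (metis (mono_tags, lifting) someI_ex)+
  then show "matrix_inv (mass_matrix v) *v (mass_matrix v *v b) = b"
    "mass_matrix v *v (matrix_inv (mass_matrix v) *v b) = b"
    by (simp_all add: matrix_vector_mul_assoc)
qed

lemma J_hat_mult:
  "J_hat \<psi> J v a *v b =
    matrix_inv (mass_matrix v) *v (J_matrix \<psi> J v a *v (matrix_inv (mass_matrix v) *v b))"
  by (simp add: J_hat_def matrix_vector_mul_assoc matrix_mul_assoc)

text \<open>The outer inverse mass matrix is injective and drops out. The inner one is undone by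
  substituting \<open>b = mass_matrix v *v c\<close>.\<close>

lemma kernel_J_hat:
  assumes "galerkin_basis \<psi> \<theta> s v"
  shows "{b. J_hat \<psi> J v a *v b = 0} = (\<lambda>c. mass_matrix v *v c) ` {c. J_matrix \<psi> J v a *v c = 0}"
proof -
  note inverse = mass_matrix_inverse[OF assms]
  have "J_hat \<psi> J v a *v b = 0 \<longleftrightarrow> J_matrix \<psi> J v a *v (matrix_inv (mass_matrix v) *v b) = 0" for b
    unfolding J_hat_mult by (metis inverse(2) matrix_vector_mult_0_right)
  then show ?thesis
    using inverse by (auto intro!: image_eqI[of _ _ "matrix_inv (mass_matrix v) *v _"])
qed

lemma dim_kernel_J_hat:
  assumes "galerkin_basis \<psi> \<theta> s v"
  shows "dim {b. J_hat \<psi> J v a *v b = 0} = dim {c. J_matrix \<psi> J v a *v c = 0}"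
  unfolding kernel_J_hat[OF assms]
  by (rule dim_image_eq) (auto intro: inj_on_inverseI mass_matrix_inverse[OF assms])


text \<open>Both sides are linear in \<open>c\<close> and agree on the unit vectors. The condition
  \<open>d \<le> 2 * s\<close> places V_N in the domain of the operator, where its linearity is
  available.\<close>

lemma J_matrix_mult:
  assumes hs: "hilbert_scale \<psi> \<theta>" and "d \<le> 2 * s" and v: "galerkin_basis \<psi> \<theta> s v"
    and J: "linear_op \<theta> (- int s + int d) (- int s) (J (uN v a))"
  shows "J_matrix \<psi> J v a *v c = (\<chi> i. pairing (J (uN v a) (coef \<psi> (uN v c))) (coef \<psi> (v i)))"
proof -
  have pos: "\<And>k. 0 < \<theta> k" using hs by (simp add: hilbert_scale_def)
  define T where "T = J (uN v a)"
  define f where "f c = (\<chi> i. pairing (T (coef \<psi> (uN v c))) (coef \<psi> (v i)))" for c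
  have dom: "coef \<psi> (uN v c) \<in> X \<theta> (- int s + int d)" for c
    using uN_in_Xs[OF pos v, of c] X_mono[OF hs, of "- int s + int d" "int s"] \<open>d \<le> 2 * s\<close>
    by (auto simp: Xs_def)
  have T_in: "T (coef \<psi> (uN v c)) \<in> X \<theta> (- int s)" for c
    using J dom unfolding linear_op_def T_def by blast
  have v_in: "coef \<psi> (v i) \<in> X \<theta> (int s)" for i
    using v by (auto simp: galerkin_basis_def Xs_def)
  have "linear f"
  proof (rule linearI)
    fix b c
    have "T (coef \<psi> (uN v (b + c))) = T (coef \<psi> (uN v b)) + T (coef \<psi> (uN v c))"
      using J dom[of b] dom[of c] unfolding linear_op_def T_def linear_add[OF linear_uN] coef_add by blast
    then show "f (b + c) = f b + f c"
      by (simp add: f_def vec_eq_iff pairing_add_left[OF pos T_in T_in v_in])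
  next
    fix r c
    have "T (coef \<psi> (uN v (r *\<^sub>R c))) = r *\<^sub>R T (coef \<psi> (uN v c))"
      using J dom[of c] unfolding linear_op_def T_def linear_scale[OF linear_uN] coef_scaleR by blast
    then show "f (r *\<^sub>R c) = r *\<^sub>R f c"
      by (simp add: f_def vec_eq_iff pairing_scaleR_left)
  qed
  moreover have "matrix f = J_matrix \<psi> J v a"
    by (simp add: matrix_def J_matrix_def f_def uN_axis T_def)
  ultimately have "J_matrix \<psi> J v a *v c = f c"
    by (metis matrix_vector_mul(2))
  then show ?thesis by (simp add: f_def T_def)
qed

lemma pairing_zero_on_VN:
  assumes pos: "\<And>k. 0 < \<theta> k" and v: "galerkin_basis \<psi> \<theta> s v" and y: "y \<in> X \<theta> (- int s)"
    and zero: "\<And>i. pairing y (coef \<psi> (v i)) = 0" and z: "z \<in> VN v"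
  shows "pairing y (coef \<psi> z) = 0"
proof -
  note sub = subspace_Xs[of \<theta> \<psi> s, OF pos]
  have "subspace {z \<in> Xs \<psi> \<theta> s. pairing y (coef \<psi> z) = 0}"
  proof (rule subspaceI)
    show "0 \<in> {z \<in> Xs \<psi> \<theta> s. pairing y (coef \<psi> z) = 0}"
      using subspace_0[OF sub] by (simp add: linear_0[OF linear_coef] pairing_zero_right)
    show "x + z \<in> {z \<in> Xs \<psi> \<theta> s. pairing y (coef \<psi> z) = 0}"
      if "x \<in> {z \<in> Xs \<psi> \<theta> s. pairing y (coef \<psi> z) = 0}"
        "z \<in> {z \<in> Xs \<psi> \<theta> s. pairing y (coef \<psi> z) = 0}" for x z
      using that subspace_add[OF sub, of x z] pairing_add_right[OF pos y, of "coef \<psi> x" "coef \<psi> z"]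
      by (simp add: coef_add) (simp add: Xs_def)
    show "c *\<^sub>R x \<in> {z \<in> Xs \<psi> \<theta> s. pairing y (coef \<psi> z) = 0}"
      if "x \<in> {z \<in> Xs \<psi> \<theta> s. pairing y (coef \<psi> z) = 0}" for c x
      using that subspace_scale[OF sub, of x c] by (simp add: coef_scaleR pairing_scaleR_right)
  qed
  then have "VN v \<subseteq> {z \<in> Xs \<psi> \<theta> s. pairing y (coef \<psi> z) = 0}"
    unfolding VN_def using v zero by (intro span_minimal) (auto simp: galerkin_basis_def)
  then show ?thesis using z by blast
qed

section \<open>Dimension of the discrete kernel\<close>

text \<open>Because \<open>K\<close> lies in the range, \<open>g\<close> maps the preimage
  isomorphically onto \<open>K\<close>, so a basis of the preimage is sent to a basis of
  \<open>K\<close>.\<close>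

lemma dim_vimage_injective:
  fixes g :: "'a::real_vector \<Rightarrow> 'b::real_vector"
  assumes g: "linear g" "inj g" and K: "has_finite_dim K r" "K \<subseteq> range g"
  shows "dim (g -` K) = r"
proof -
  obtain B where B: "independent B" "span B = K" "card B = r"
    using K(1) by (auto simp: has_finite_dim_def)
  have "subspace K" using B(2) by (metis subspace_span)
  then have sub: "subspace (g -` K)" using g(1) by (rule linear_subspace_vimage[rotated])
  obtain C where C: "C \<subseteq> g -` K" "independent C" "g -` K \<subseteq> span C" "card C = dim (g -` K)"
    by (rule basis_exists)
  have "span C = g -` K" using C(1,3) sub by (simp add: span_minimal subset_antisym)
  then have "span (g ` C) = span K"
    using K(2) by (simp add: linear_span_image[OF g(1)] image_vimage_eq Int_absorb2 span_eq_iff[THEN iffD2, OF \<open>subspace K\<close>])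
  moreover have "independent (g ` C)" by (rule linear_independent_injective_image[OF g(1) C(2)]) (rule inj_on_subset[OF g(2) subset_UNIV])
  ultimately have "dim K = card (g ` C)" by (rule dim_eq_card)
  also have "card (g ` C) = card C" using g(2) by (intro card_image) (rule inj_on_subset, auto)
  finally have "dim K = dim (g -` K)" using C(4) by simp
  moreover have "dim K = r"
    using dim_eq_card[of B K] B by (simp add: span_eq_iff[THEN iffD2, OF \<open>subspace K\<close>])
  ultimately show ?thesis by simp
qed

text \<open>Two subspaces of coordinate vectors are compared: \<open>B\<close>, the preimage of the
  continuous kernel, of dimension \<open>r\<close>, and \<open>A\<close>, the kernel of
  \<open>J_matrix\<close>. A vector killed by the operator is killed by its compression to V_N, so
  \<open>B\<close> lies in \<open>A\<close>. The converse inclusion is the stated criterion.\<close>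

lemma dim_discrete_kernel:
  fixes v :: "'n::finite \<Rightarrow> 'h::{real_inner,complete_space}"
  assumes hs: "hilbert_scale \<psi> \<theta>" and sd: "d \<le> 2 * s" and v: "galerkin_basis \<psi> \<theta> s v"
    and J: "linear_op \<theta> (- int s + int d) (- int s) (J (uN v a))"
    and K: "has_finite_dim (ker_op \<theta> s d (J (uN v a))) r"
      "ker_op \<theta> s d (J (uN v a)) \<subseteq> coef \<psi> ` VN v"
  shows "r \<le> dim {b. J_hat \<psi> J v a *v b = 0}" (is "_ \<le> dim ?N")
    and "dim {b. J_hat \<psi> J v a *v b = 0} = r \<longleftrightarrow>
      (\<forall>w\<in>VN v. (\<forall>z\<in>VN v. pairing (J (uN v a) (coef \<psi> w)) (coef \<psi> z) = 0) \<longrightarrow>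
        coef \<psi> w \<in> ker_op \<theta> s d (J (uN v a)))"
proof -
  have pos: "\<And>k. 0 < \<theta> k" and basis: "hilbert_basis \<psi>" using hs by (simp_all add: hilbert_scale_def)
  define T where "T = J (uN v a)"
  define g where "g = coef \<psi> \<circ> uN v"
  have g: "linear g" "inj g"
    unfolding g_def using inj_coef[OF basis] inj_uN[OF v]
    by (simp_all add: linear_compose[OF linear_uN linear_coef] inj_compose)
  have range_g: "range g = coef \<psi> ` VN v" by (simp add: g_def image_comp flip: range_uN)
  have mult: "J_matrix \<psi> J v a *v c = (\<chi> i. pairing (T (g c)) (coef \<psi> (v i)))" for c
    using J_matrix_mult[where J = J, OF hs sd v J] by (simp add: T_def g_def)
  define A where "A = {c. J_matrix \<psi> J v a *v c = 0}"
  define B where "B = g -` ker_op \<theta> s d T"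
  have A_dim: "dim ?N = dim A" unfolding A_def by (rule dim_kernel_J_hat[OF v])
  have B_dim: "dim B = r"
    unfolding B_def T_def by (rule dim_vimage_injective[OF g K(1)]) (use K(2) range_g in simp)
  have "B \<subseteq> A"
    by (auto simp: A_def B_def mult ker_op_def pairing_zero_left vec_eq_iff)
  then have BA: "dim B \<le> dim A" by (rule dim_subset)
  then show "r \<le> dim ?N" by (simp add: A_dim B_dim)
  have "subspace A"
    unfolding A_def by (rule linear_subspace_kernel) (rule matrix_vector_mul_linear)
  moreover have "subspace (ker_op \<theta> s d T)"
    using K(1) unfolding has_finite_dim_def T_def by (metis subspace_span)
  then have "subspace B" unfolding B_def by (rule linear_subspace_vimage[OF g(1)])
  \<comment> \<open>For nested finite-dimensional subspaces, equal dimension means equality.\<close>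
  ultimately have "dim A = dim B \<longleftrightarrow> A \<subseteq> B"
    using \<open>B \<subseteq> A\<close> BA subspace_dim_equal[of B A] dim_subset[of A B] by auto
  moreover have "c \<in> A \<longleftrightarrow> (\<forall>z\<in>VN v. pairing (T (g c)) (coef \<psi> z) = 0)" for c
  proof
    assume "c \<in> A"
    then have zero: "pairing (T (g c)) (coef \<psi> (v i)) = 0" for i by (simp add: A_def mult vec_eq_iff)
    have "g c \<in> X \<theta> (int s)" using uN_in_Xs[OF pos v, of c] by (simp add: g_def Xs_def)
    then have "g c \<in> X \<theta> (- int s + int d)"
      using X_mono[OF hs, of "- int s + int d" "int s"] sd by auto
    then have "T (g c) \<in> X \<theta> (- int s)" using J by (auto simp: linear_op_def T_def)
    then show "\<forall>z\<in>VN v. pairing (T (g c)) (coef \<psi> z) = 0"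
      using pairing_zero_on_VN[OF pos v _ zero] by blast
  next
    assume "\<forall>z\<in>VN v. pairing (T (g c)) (coef \<psi> z) = 0"
    moreover have "v i \<in> VN v" for i by (simp add: VN_def span_base)
    ultimately show "c \<in> A" by (simp add: A_def mult vec_eq_iff)
  qed
  ultimately show "dim ?N = r \<longleftrightarrow> (\<forall>w\<in>VN v. (\<forall>z\<in>VN v. pairing (J (uN v a) (coef \<psi> w)) (coef \<psi> z) = 0) \<longrightarrow>
        coef \<psi> w \<in> ker_op \<theta> s d (J (uN v a)))"
    unfolding A_dim B_dim[symmetric] T_def[symmetric] range_uN[symmetric]
    by (auto simp: B_def g_def subset_iff)
qed

section \<open>Restrictions of Casimirs to the Galerkin space\<close>

lemma discrete_casimir_restrict:
  fixes v :: "'n::finite \<Rightarrow> 'h::{real_inner,complete_space}"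
  assumes hs: "hilbert_scale \<psi> \<theta>" and sd: "d \<le> 2 * s" and v: "galerkin_basis \<psi> \<theta> s v"
    and J: "\<And>u. u \<in> Xs \<psi> \<theta> s \<Longrightarrow> linear_op \<theta> (- int s + int d) (- int s) (J u)"
    and K: "\<And>u. u \<in> Xs \<psi> \<theta> s \<Longrightarrow> ker_op \<theta> s d (J u) \<subseteq> coef \<psi> ` VN v"
    and F: "casimir \<psi> \<theta> s d J F"
  shows "discrete_casimir (J_hat \<psi> J v) (\<lambda>a. F (uN v a))"
proof -
  have pos: "\<And>k. 0 < \<theta> k" and basis: "hilbert_basis \<psi>" using hs by (simp_all add: hilbert_scale_def)
  note in_Xs = uN_in_Xs[of \<theta>, OF pos v]
  have C1: "C1_functional \<psi> \<theta> s F" using F by (simp add: casimir_def functional_in_def)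
  have "J_hat \<psi> J v a *v gradient (\<lambda>a. F (uN v a)) a = 0" for a
  proof -
    obtain D where D: "has_frechet \<psi> \<theta> s F D (uN v a)"
      using C1 in_Xs[of a] unfolding C1_functional_def by blast
    define x where "x = variation \<psi> \<theta> s F (uN v a)"
    have x: "x \<in> ker_op \<theta> s d (J (uN v a))"
      unfolding x_def by (rule casimir_variation_in_kernel[OF pos basis F in_Xs])
    \<comment> \<open>Here the inclusion of the kernel in V_N enters: the variation itself has
      Galerkin coordinates \<open>b\<close>.\<close>
    then obtain b where b: "x = coef \<psi> (uN v b)"
      using K[OF in_Xs[of a]] unfolding range_uN[symmetric] by blast
    have "v i \<in> Xs \<psi> \<theta> s" for i using v by (auto simp: galerkin_basis_def)
    from pairing_variation[OF pos basis D this] have "D (v i) = uN v b \<bullet> v i" for i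
      unfolding x_def[symmetric] b pairing_coef[OF basis] by simp
    then have "gradient (\<lambda>a. F (uN v a)) a = mass_matrix v *v b"
      by (simp add: gradient_restrict[OF pos v D] mass_matrix_mult)
    moreover have "J_matrix \<psi> J v a *v b = 0"
      using x by (simp add: J_matrix_mult[where J = J, OF hs sd v J[OF in_Xs]] ker_op_def
          pairing_zero_left vec_eq_iff flip: b)
    ultimately show ?thesis
      by (simp add: J_hat_mult mass_matrix_inverse[OF v])
  qed
  then show ?thesis
    by (simp add: discrete_casimir_def discrete_bracket_def C1_fun_restrict[OF pos v C1])
qed

text \<open>The derivative along V_N is the pairing of the variation, a kernel element, with vectors
  of V_N. It vanishes, and a function on all of \<open>real ^ 'n\<close> with zero derivative is
  constant.\<close>

lemma casimir_constant_on_VN: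
  fixes v :: "'n::finite \<Rightarrow> 'h::{real_inner,complete_space}"
  assumes hs: "hilbert_scale \<psi> \<theta>" and v: "galerkin_basis \<psi> \<theta> s v"
    and K: "\<And>u x w. u \<in> Xs \<psi> \<theta> s \<Longrightarrow> x \<in> ker_op \<theta> s d (J u) \<Longrightarrow> w \<in> VN v \<Longrightarrow> pairing x (coef \<psi> w) = 0"
    and F: "casimir \<psi> \<theta> s d J F"
  shows "F constant_on VN v"
proof -
  have pos: "\<And>k. 0 < \<theta> k" and basis: "hilbert_basis \<psi>" using hs by (simp_all add: hilbert_scale_def)
  note in_Xs = uN_in_Xs[of \<theta>, OF pos v]
  have "((\<lambda>a. F (uN v a)) has_derivative (\<lambda>h. 0)) (at a)" for a
  proof -
    obtain D where D: "has_frechet \<psi> \<theta> s F D (uN v a)"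
      using F in_Xs[of a] unfolding casimir_def functional_in_def C1_functional_def by blast
    have "uN v h \<in> VN v" for h by (simp flip: range_uN)
    then have "D (uN v h) = 0" for h
      using K[OF in_Xs casimir_variation_in_kernel[OF pos basis F in_Xs]]
        pairing_variation[OF pos basis D in_Xs] by metis
    then show ?thesis using has_derivative_restrict[OF pos v D] by simp
  qed
  then have "\<exists>c. \<forall>a\<in>UNIV. F (uN v a) = c"
    by (intro has_derivative_zero_constant) auto
  then show ?thesis unfolding constant_on_def range_uN[symmetric] by auto
qed

text \<open>In coordinates, multiplication by \<open>\<theta> k powi (2 * int s)\<close> becomes a
  linear map \<open>f\<close> of \<open>real ^ 'n\<close>. Positive weights make it injective, hence
  surjective, so every \<open>w\<close> in V_N is the weighted image of some element of V_N.\<close>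

lemma orthogonal_VN_weighted:
  fixes v :: "'n::finite \<Rightarrow> 'h::{real_inner,complete_space}"
  assumes hs: "hilbert_scale \<psi> \<theta>" and v: "galerkin_basis \<psi> \<theta> s v"
    and invariant: "\<And>w. w \<in> VN v \<Longrightarrow> \<exists>z\<in>VN v. coef \<psi> z = (\<lambda>k. \<theta> k powi (2 * int s) * coef \<psi> w k)"
    and orth: "\<And>w. w \<in> VN v \<Longrightarrow> X_inner \<theta> (int s) x (coef \<psi> w) = 0" and w: "w \<in> VN v"
  shows "pairing x (coef \<psi> w) = 0"
proof -
  have pos: "\<And>k. 0 < \<theta> k" and basis: "hilbert_basis \<psi>" using hs by (simp_all add: hilbert_scale_def)
  define g where "g = coef \<psi> \<circ> uN v"
  have g: "linear g" "inj g"
    unfolding g_def using inj_coef[OF basis] inj_uN[OF v]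
    by (simp_all add: linear_compose[OF linear_uN linear_coef] inj_compose)
  have "\<exists>b. g b = (\<lambda>k. \<theta> k powi (2 * int s) * g a k)" for a
    using invariant[of "uN v a"] unfolding range_uN[symmetric] by (auto simp: g_def)
  then obtain f where f: "\<And>a. g (f a) = (\<lambda>k. \<theta> k powi (2 * int s) * g a k)" by metis
  have "linear f"
  proof (rule linearI)
    show "f (a + b) = f a + f b" for a b
      by (rule injD[OF g(2)])
        (simp add: f linear_add[OF g(1)] plus_fun_def distrib_left)
    show "f (c *\<^sub>R a) = c *\<^sub>R f a" for c a
      by (rule injD[OF g(2)])
        (simp add: f linear_scale[OF g(1)] scaleR_fun_def mult.left_commute)
  qed
  moreover have "inj f"
  proof (rule injI)
    fix a b assume "f a = f b"
    then have "(\<lambda>k. \<theta> k powi (2 * int s) * g a k) = (\<lambda>k. \<theta> k powi (2 * int s) * g b k)"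
      by (metis f)
    then have "g a = g b" using pos by (simp add: fun_eq_iff less_imp_neq[OF pos, symmetric])
    then show "a = b" using g(2) by (simp add: inj_eq)
  qed
  ultimately have "surj f" by (rule linear_injective_imp_surjective) (rule refl)
  obtain a where "w = uN v a" using w unfolding range_uN[symmetric] by blast
  moreover obtain b where "a = f b" using \<open>surj f\<close> by (auto elim: surjE)
  ultimately have "coef \<psi> w = (\<lambda>k. \<theta> k powi (2 * int s) * coef \<psi> (uN v b) k)"
    using f[of b] by (simp add: g_def)
  \<comment> \<open>The weight absorbed into \<open>w\<close> is the one in the inner product of
    X_s, so the two series coincide term by term.\<close>
  then have "pairing x (coef \<psi> w) = X_inner \<theta> (int s) x (coef \<psi> (uN v b))"
    by (simp add: pairing_def X_inner_def mult_ac)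
  also have "\<dots> = 0" by (rule orth) (simp flip: range_uN)
  finally show ?thesis .
qed

text \<open>Compression to V_N can create null vectors: a \<open>w\<close> in V_N whose image under
  \<open>J (uN v a)\<close> is nonzero but annihilates V_N enters the discrete kernel. Moreover
  skew-adjointness makes \<open>J_matrix\<close> skew-symmetric, so the kernel dimension has the
  parity of \<open>CARD('n)\<close> and cannot be \<open>r\<close> when \<open>CARD('n) - r\<close>
  is odd. The dimension is therefore bounded below by \<open>r\<close>, with an exact criterion for
  equality. Derivatives are expressed by the pairing, so constancy is stated for orthogonality in
  the pairing, and for orthogonality in X_s when V_N is invariant under the weights.\<close>

theorem proposition4p5:
  fixes \<psi> :: "int \<Rightarrow> 'h::{real_inner,complete_space}"
    and \<theta> :: "int \<Rightarrow> real"
    and s d :: nat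
    and J :: "'h \<Rightarrow> (int \<Rightarrow> real) \<Rightarrow> int \<Rightarrow> real"
    and v :: "'n::finite \<Rightarrow> 'h"
  assumes "hilbert_scale \<psi> \<theta>"
    and "s > 0" and "d > 0" and "2 * s \<ge> d"
    and "poisson_operator \<psi> \<theta> s d J"
    and "galerkin_basis \<psi> \<theta> s v"
  shows
    "(\<forall>r. r \<le> CARD('n) \<and>
          (\<forall>u\<in>Xs \<psi> \<theta> s. has_finite_dim (ker_op \<theta> s d (J u)) r \<and>
                        ker_op \<theta> s d (J u) \<subseteq> coef \<psi> ` VN v) \<longrightarrow>
       (\<forall>a. r \<le> dim {b. J_hat \<psi> J v a *v b = 0} \<and>
            (dim {b. J_hat \<psi> J v a *v b = 0} = r \<longleftrightarrow>
               (\<forall>w\<in>VN v. (\<forall>z\<in>VN v. pairing (J (uN v a) (coef \<psi> w)) (coef \<psi> z) = 0) \<longrightarrow>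
                          coef \<psi> w \<in> ker_op \<theta> s d (J (uN v a))))) \<and>
       (\<forall>F. casimir \<psi> \<theta> s d J F \<longrightarrow> discrete_casimir (J_hat \<psi> J v) (\<lambda>a. F (uN v a)))) \<and>
     ((\<forall>u\<in>Xs \<psi> \<theta> s. \<forall>x\<in>ker_op \<theta> s d (J u). \<forall>w\<in>VN v. pairing x (coef \<psi> w) = 0) \<longrightarrow>
       (\<forall>F. casimir \<psi> \<theta> s d J F \<longrightarrow> F constant_on VN v)) \<and>
     ((\<forall>w\<in>VN v. \<exists>z\<in>VN v. coef \<psi> z = (\<lambda>k. \<theta> k powi (2 * int s) * coef \<psi> w k)) \<and>
      (\<forall>u\<in>Xs \<psi> \<theta> s. \<forall>x\<in>ker_op \<theta> s d (J u). \<forall>w\<in>VN v. X_inner \<theta> (int s) x (coef \<psi> w) = 0) \<longrightarrow>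
       (\<forall>F. casimir \<psi> \<theta> s d J F \<longrightarrow> F constant_on VN v))"
proof -
  have J: "linear_op \<theta> (- int s + int d) (- int s) (J u)" if "u \<in> Xs \<psi> \<theta> s" for u
    using assms(5) that by (simp add: poisson_operator_def Let_def)
  have pos: "\<And>k. 0 < \<theta> k" using assms(1) by (simp add: hilbert_scale_def)
  note in_Xs = uN_in_Xs[of \<theta>, OF pos assms(6)]
  note kernel = dim_discrete_kernel[where J = J, OF assms(1,4,6) J[OF in_Xs]]
  note discrete = discrete_casimir_restrict[where J = J, OF assms(1,4,6) J]
  note const = casimir_constant_on_VN[OF assms(1,6)]
  note weighted = orthogonal_VN_weighted[OF assms(1,6)]
  show ?thesis
  proof (intro conjI allI impI; (elim conjE)?)
    fix r a
    assume K: "\<forall>u\<in>Xs \<psi> \<theta> s. has_finite_dim (ker_op \<theta> s d (J u)) r \<and>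
      ker_op \<theta> s d (J u) \<subseteq> coef \<psi> ` VN v"
    show "r \<le> dim {b. J_hat \<psi> J v a *v b = 0}"
      using kernel(1) K in_Xs by blast
    show "dim {b. J_hat \<psi> J v a *v b = 0} = r \<longleftrightarrow>
      (\<forall>w\<in>VN v. (\<forall>z\<in>VN v. pairing (J (uN v a) (coef \<psi> w)) (coef \<psi> z) = 0) \<longrightarrow>
        coef \<psi> w \<in> ker_op \<theta> s d (J (uN v a)))"
      by (rule kernel(2)) (use K in_Xs in blast)+
  next
    fix r F
    assume "\<forall>u\<in>Xs \<psi> \<theta> s. has_finite_dim (ker_op \<theta> s d (J u)) r \<and>
      ker_op \<theta> s d (J u) \<subseteq> coef \<psi> ` VN v" and "casimir \<psi> \<theta> s d J F"
    then show "discrete_casimir (J_hat \<psi> J v) (\<lambda>a. F (uN v a))"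
      using discrete by blast
  next
    fix F
    assume "\<forall>u\<in>Xs \<psi> \<theta> s. \<forall>x\<in>ker_op \<theta> s d (J u). \<forall>w\<in>VN v. pairing x (coef \<psi> w) = 0"
      and "casimir \<psi> \<theta> s d J F"
    then show "F constant_on VN v" using const by blast
  next
    fix F
    assume "\<forall>w\<in>VN v. \<exists>z\<in>VN v. coef \<psi> z = (\<lambda>k. \<theta> k powi (2 * int s) * coef \<psi> w k)"
      and "\<forall>u\<in>Xs \<psi> \<theta> s. \<forall>x\<in>ker_op \<theta> s d (J u). \<forall>w\<in>VN v. X_inner \<theta> (int s) x (coef \<psi> w) = 0"
      and F: "casimir \<psi> \<theta> s d J F"
    then have "pairing x (coef \<psi> w) = 0"
      if "u \<in> Xs \<psi> \<theta> s" "x \<in> ker_op \<theta> s d (J u)" "w \<in> VN v" for u x w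
      by (intro weighted) (use that in blast)+
    then show "F constant_on VN v" using const[OF _ F] by blast
  qed
qed

end
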